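(* Let $C(p)=\{x\in\mathcal H \mid \langle x\mid g_i(p)\rangle=f_i(p),\ i\in I_1,\ \langle x\mid g_i(p)\rangle\le f_i(p),\ i\in I_2\}$ for $p\in\mathcal D$. Let $\bar p\in\mathcal D$, $\bar x\in C(\bar p)$, $I_{\bar p}(\bar x)\ne\emptyset$ and $\bar v-\bar x\in N(\bar x;C(\bar p))$. Assume that there exists an equivalent representation $\mathcal R$ of $p\mapsto C(p)$ such that - RCRCQ holds for $\mathcal R$ at $(\bar p,\bar x)$; - $\mathcal R$ is a stable representation at $(\bar p,\bar v,\bar x)$ with some set $\bar K\subset I^{\mathcal R}_{\bar p}(\bar x)\cap\tilde I_2$, with $\bar v-\bar x=\sum_{i\in\tilde I_1\cup\bar K}\bar\lambda_i\tilde g_i(\bar p)$ the corresponding representation. Then there exists a constant $\ell>0$ such that for all $\varepsilon>0$ one can find neighbourhoods $U(\bar p)$ of $\bar p$ and $V(0)$ of $0\in\mathcal H$ satisfying: (1) for any $p\in U(\bar p)$ and any $x\in C(p)\cap(\bar x+V(0))$, $x'\in N(x;C(p))\cap(\bar v-\bar x+V(0))$, there exists $\hat L\subset(I^{\mathcal R}_p(x)\cap\tilde I_2)\setminus\bar K\subset(I^{\mathcal R}_{\bar p}(\bar x)\cap\tilde I_2)\setminus\bar K$ such that $\tilde g_i(\bar p)$, $i\in\tilde I_1\cup\bar K\cup\hat L$, are linearly independent, and there exist $\lambda_i$, $i\in\tilde I_1\cup\bar K\cup\hat L$, with $$x'=\sum_{i\in\tilde I_1\cup\bar K\cup\hat L}\lambda_i\tilde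 g_i(p),\qquad \bar\lambda_i-\varepsilon\le\lambda_i\le\bar\lambda_i+\varepsilon\ \ \forall i\in\tilde I_1\cup\bar K,\qquad 0<\lambda_i\le\varepsilon\ \ \forall i\in\hat L;$$ (2) for every $L\subset(I^{\mathcal R}_{\bar p}(\bar x)\cap\tilde I_2)\setminus\bar K$ such that $\tilde g_i(\bar p)$, $i\in\tilde I_1\cup\bar K\cup L$, are linearly independent, for every $p_1,p_2\in U(\bar p)$ and every $x_1\in(\bar x+V(0))\cap R_{\bar K,L}(p_1)$ there exists $x_2\in R_{\bar K,L}(p_2)$ such that $\|x_1-x_2\|\le\ell\|p_1-p_2\|$.
   Context: $\mathcal H$ is a real Hilbert space with inner product $\langle\cdot\mid\cdot\rangle$, $\mathcal D$ is a nonempty subset of a normed space $\mathcal G$ with the induced topology (neighbourhoods of $\bar p$ are relative to $\mathcal D$). The index sets are $I_1=\emptyset$ or $\{1,\dots,q\}$, $I_2=\emptyset$ or $\{q+1,\dots,m\}$, $I_1\cup I_2\neq\emptyset$; $f_i:\mathcal D\to\mathbb R$, $g_i:\mathcal D\to\mathcal H$ are locally Lipschitz on $\mathcal D$. $I_p(x)=\{i\in I_1\cup I_2\mid\langle x\mid g_i(p)\rangle=f_i(p)\}$. For $x\in C(p)$, $N(x;C(p))=\{h\in\mathcal H\mid\langle h\mid y-x\rangle\le0\ \forall y\in C(p)\}$. Lower Kuratowski limit: for a multifunction $F:\mathcal D\rightrightarrows\mathcal H$, $\liminf_{p\to\bar p,\,p\in\mathcal D}F(p)$ is the set of $y\in\mathcal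 H$ such that for every sequence $p_k\to\bar p$, $p_k\in\mathcal D$, there exist $y_k\in F(p_k)$ with $y_k\to y$. Equivalent representation: a multifunction $\mathcal R:p\mapsto R(p)$ with $R(p)=C(p)$ for all $p\in\mathcal D$, where $R(p)$ is given (together with its describing data) as $R(p)=\{x\in\mathcal H\mid\langle x\mid\tilde g_i(p)\rangle=\tilde f_i(p),\ i\in\tilde I_1,\ \langle x\mid\tilde g_i(p)\rangle\le\tilde f_i(p),\ i\in\tilde I_2\}$, with $\tilde I_1,\tilde I_2$ disjoint index sets, $\tilde I_1\cup\tilde I_2$ finite and nonempty, and $\tilde f_i:\mathcal D\to\mathbb R$, $\tilde g_i:\mathcal D\to\mathcal H$ locally Lipschitz on $\mathcal D$. Put $I^{\mathcal R}_p(x)=\{i\in\tilde I_1\cup\tilde I_2\mid\langle x\mid\tilde g_i(p)\rangle=\tilde f_i(p)\}$. RCRCQ holds for $\mathcal R$ at $(\bar p,\bar x)$ if there is a neighbourhood $U(\bar p)$ such that for every $J$ with $\tilde I_1\subset J\subset I^{\mathcal R}_{\bar p}(\bar x)$ and every $p\in U(\bar p)$, $\mathrm{rank}\{\tilde g_i(p),i\in J\}=\mathrm{rank}\{\tilde g_i(\bar p),i\in J\}$. Stable representation: for $\bar p\in\mathcal D$, $\bar v\notin C(\bar p)$, $\bar x\in C(\bar p)$, an equivalent representation $\mathcal R$ is stable at $(\bar p,\bar v,\bar x)$ with the set $\bar K\subset I^{\mathcal R}_{\bar p}(\bar x)\cap\tilde I_2$ (possibly empty) if: (i) $\bar v-\bar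 x=\sum_{i\in\tilde I_1\cup\bar K}\bar\lambda_i\tilde g_i(\bar p)$ with $\bar\lambda_i>0$ for $i\in\bar K$ and $\tilde g_i(\bar p)$, $i\in\tilde I_1\cup\bar K$, linearly independent; and (ii) for every (possibly empty) $L\subset(I^{\mathcal R}_{\bar p}(\bar x)\cap\tilde I_2)\setminus\bar K$ such that $\tilde g_i(\bar p)$, $i\in\tilde I_1\cup\bar K\cup L$, are linearly independent, $\bar x\in\liminf_{p\to\bar p,\,p\in\mathcal D}R_{\bar K,L}(p)$, where $R_{\bar K,L}(p)=\{x\in\mathcal H\mid\langle x\mid\tilde g_i(p)\rangle=\tilde f_i(p),\ i\in\tilde I_1\cup\bar K\cup L,\ \langle x\mid\tilde g_i(p)\rangle\le\tilde f_i(p),\ i\in\tilde I_2\setminus(\bar K\cup L)\}$. (In particular stability at $(\bar p,\bar v,\bar x)$ includes $\bar v\notin C(\bar p)$.) *)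

theory Defs
  imports "HOL-Analysis.Analysis"
begin

definition locally_lipschitz_on ::
    "'p::metric_space set \<Rightarrow> ('p \<Rightarrow> 'b::metric_space) \<Rightarrow> bool" where
  "locally_lipschitz_on D f \<longleftrightarrow>
     (\<forall>p\<in>D. \<exists>u>0. \<exists>L. L-lipschitz_on (ball p u \<inter> D) f)"

text \<open>A parametric system of linear equations (indices \<open>E\<close>) and inequalities (indices \<open>I\<close>) is
  passed around as its describing data \<open>E I g f\<close>; conditions such as RCRCQ depend on these data and
  not only on the solution sets.\<close>

definition solution_set ::
    "'i set \<Rightarrow> 'i set \<Rightarrow> ('i \<Rightarrow> 'p \<Rightarrow> 'h::real_inner) \<Rightarrow> ('i \<Rightarrow> 'p \<Rightarrow> real) \<Rightarrow> 'p \<Rightarrow> 'h set" where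
  "solution_set E I g f p =
     {x. (\<forall>i\<in>E. x \<bullet> g i p = f i p) \<and> (\<forall>i\<in>I. x \<bullet> g i p \<le> f i p)}"

definition active_indices ::
    "'i set \<Rightarrow> 'i set \<Rightarrow> ('i \<Rightarrow> 'p \<Rightarrow> 'h::real_inner) \<Rightarrow> ('i \<Rightarrow> 'p \<Rightarrow> real) \<Rightarrow> 'p \<Rightarrow> 'h \<Rightarrow> 'i set" where
  "active_indices E I g f p x = {i \<in> E \<union> I. x \<bullet> g i p = f i p}"

definition normal_cone :: "'h::real_inner \<Rightarrow> 'h set \<Rightarrow> 'h set" where
  "normal_cone x S = {h. \<forall>y\<in>S. h \<bullet> (y - x) \<le> 0}"

definition lower_kuratowski_limit ::
    "'p::topological_space set \<Rightarrow> 'p \<Rightarrow> ('p \<Rightarrow> 'h::topological_space set) \<Rightarrow> 'h set" where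
  "lower_kuratowski_limit D pbar F =
     {y. \<forall>ps. (\<forall>k::nat. ps k \<in> D) \<and> ps \<longlonglongrightarrow> pbar \<longrightarrow>
           (\<exists>ys. (\<forall>k. ys k \<in> F (ps k)) \<and> ys \<longlonglongrightarrow> y)}"

text \<open>Linear independence of an indexed family: two equal vectors with different indices are
  dependent, which \<^const>\<open>independent\<close> alone, being about sets, would not see.\<close>

definition independent_family :: "'i set \<Rightarrow> ('i \<Rightarrow> 'h::real_vector) \<Rightarrow> bool" where
  "independent_family J v \<longleftrightarrow> inj_on v J \<and> independent (v ` J)"

definition equivalent_representation ::
    "'p::metric_space set \<Rightarrow> ('p \<Rightarrow> 'h set) \<Rightarrow>
     'i set \<Rightarrow> 'i set \<Rightarrow> ('i \<Rightarrow> 'p \<Rightarrow> 'h::real_inner) \<Rightarrow> ('i \<Rightarrow> 'p \<Rightarrow> real) \<Rightarrow> bool" where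
  "equivalent_representation D C E I g f \<longleftrightarrow>
     E \<inter> I = {} \<and> finite (E \<union> I) \<and> E \<union> I \<noteq> {} \<and>
     (\<forall>i\<in>E \<union> I. locally_lipschitz_on D (f i) \<and> locally_lipschitz_on D (g i)) \<and>
     (\<forall>p\<in>D. solution_set E I g f p = C p)"

definition RCRCQ ::
    "'p::topological_space set \<Rightarrow> 'i set \<Rightarrow> 'i set \<Rightarrow> ('i \<Rightarrow> 'p \<Rightarrow> 'h::real_inner) \<Rightarrow>
     ('i \<Rightarrow> 'p \<Rightarrow> real) \<Rightarrow> 'p \<Rightarrow> 'h \<Rightarrow> bool" where
  "RCRCQ D E I g f pbar xbar \<longleftrightarrow>
     (\<exists>U. openin (top_of_set D) U \<and> pbar \<in> U \<and>
        (\<forall>J. E \<subseteq> J \<and> J \<subseteq> active_indices E I g f pbar xbar \<longrightarrow>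
           (\<forall>p\<in>U. dim ((\<lambda>i. g i p) ` J) = dim ((\<lambda>i. g i pbar) ` J))))"

text \<open>The set \<open>R\<^sub>K\<^sub>,\<^sub>L(p)\<close>: the inequalities indexed by \<open>K \<union> L\<close> are turned into equations.\<close>

definition tightened_set ::
    "'i set \<Rightarrow> 'i set \<Rightarrow> ('i \<Rightarrow> 'p \<Rightarrow> 'h::real_inner) \<Rightarrow> ('i \<Rightarrow> 'p \<Rightarrow> real) \<Rightarrow>
     'i set \<Rightarrow> 'i set \<Rightarrow> 'p \<Rightarrow> 'h set" where
  "tightened_set E I g f K L p = solution_set (E \<union> K \<union> L) (I - (K \<union> L)) g f p"

definition stable_representation ::
    "'p::metric_space set \<Rightarrow> ('p \<Rightarrow> 'h set) \<Rightarrow>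
     'i set \<Rightarrow> 'i set \<Rightarrow> ('i \<Rightarrow> 'p \<Rightarrow> 'h::real_inner) \<Rightarrow> ('i \<Rightarrow> 'p \<Rightarrow> real) \<Rightarrow>
     'p \<Rightarrow> 'h \<Rightarrow> 'h \<Rightarrow> 'i set \<Rightarrow> bool" where
  "stable_representation D C E I g f pbar vbar xbar K \<longleftrightarrow>
     equivalent_representation D C E I g f \<and>
     pbar \<in> D \<and> vbar \<notin> C pbar \<and> xbar \<in> C pbar \<and>
     K \<subseteq> active_indices E I g f pbar xbar \<inter> I \<and>
     (\<exists>lam. vbar - xbar = (\<Sum>i\<in>E \<union> K. lam i *\<^sub>R g i pbar) \<and> (\<forall>i\<in>K. lam i > 0)) \<and>
     independent_family (E \<union> K) (\<lambda>i. g i pbar) \<and>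
     (\<forall>L. L \<subseteq> (active_indices E I g f pbar xbar \<inter> I) - K \<and>
          independent_family (E \<union> K \<union> L) (\<lambda>i. g i pbar) \<longrightarrow>
        xbar \<in> lower_kuratowski_limit D pbar (tightened_set E I g f K L))"

end

theory Submission
  imports Defs
begin

text \<open>Both assertions follow from one error bound for parametric systems (\<open>error_bound\<close>): for \<open>p\<close> near
  \<open>pbar\<close> and \<open>x\<close> near \<open>xbar\<close>, the distance from \<open>x\<close> to the solution set at \<open>p\<close> is at most a fixed
  multiple of the largest constraint violation at \<open>x\<close>. It holds for every tightened system with equations
  \<open>E \<union> K \<union> L\<close> independent at \<open>pbar\<close>. The reason is that the difference between \<open>x\<close> and its projection
  is a normal vector; Farkas' lemma and a reduction of Caratheodory type (\<open>normal_cone_multipliers\<close>)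
  represent it by an independent family of active constraints, and the constant rank condition
  makes that family independent at \<open>pbar\<close>. Finitely many families are independent at \<open>pbar\<close>, and each of
  them bounds coefficients by norms of combinations, uniformly for \<open>p\<close> near \<open>pbar\<close>
  (\<open>uniform_coefficient_bound\<close>). The lower limit condition provides nearby solutions, so that the
  projection stays in the region where only constraints active at \<open>(pbar, xbar)\<close> matter.

  The Lipschitz estimate between tightened sets is immediate: a solution for \<open>p1\<close> violates the system
  for \<open>p2\<close> by a multiple of \<open>norm (p1 - p2)\<close> (\<open>solution_set_Lipschitz_like\<close>).

  For the multipliers (\<open>normal_cone_stability\<close>), the error bound for \<open>L = {}\<close> first shows that all
  constraints in \<open>K\<close> are active at \<open>x\<close>: a nearby point with the constraints in \<open>K\<close> tight would otherwise
  have a positive inner product with a vector that is normal at \<open>x\<close>. Thus the normal vector has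
  multipliers over an independent family containing \<open>E \<union> K\<close>, and the coefficient bound,
  applied to its difference with the combination of the reference multipliers, makes them close to
  those.\<close>

section \<open>Linear independence of indexed families\<close>

lemma independent_family_iff:
  fixes v :: "'i \<Rightarrow> 'h::real_vector"
  assumes "finite J"
  shows "independent_family J v \<longleftrightarrow> (\<forall>c. (\<Sum>i\<in>J. c i *\<^sub>R v i) = 0 \<longrightarrow> (\<forall>i\<in>J. c i = 0))"
proof
  assume "independent_family J v"
  then have inj: "inj_on v J" and ind: "independent (v ` J)"
    by (auto simp: independent_family_def)
  show "\<forall>c. (\<Sum>i\<in>J. c i *\<^sub>R v i) = 0 \<longrightarrow> (\<forall>i\<in>J. c i = 0)"
  proof (intro allI impI ballI)
    fix c i assume c: "(\<Sum>i\<in>J. c i *\<^sub>R v i) = 0" and i: "i \<in> J"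
    have "(\<Sum>w\<in>v ` J. c (the_inv_into J v w) *\<^sub>R w) = (\<Sum>i\<in>J. c i *\<^sub>R v i)"
      by (simp add: sum.reindex[OF inj] the_inv_into_f_f[OF inj])
    then have "c (the_inv_into J v (v i)) = 0"
      using independentD[OF ind, of "v ` J" "\<lambda>w. c (the_inv_into J v w)" "v i"] assms c i by auto
    then show "c i = 0"
      by (simp add: the_inv_into_f_f[OF inj i])
  qed
next
  assume c: "\<forall>c. (\<Sum>i\<in>J. c i *\<^sub>R v i) = 0 \<longrightarrow> (\<forall>i\<in>J. c i = 0)"
  have inj: "inj_on v J"
  proof (rule inj_onI, rule ccontr)
    fix i j assume ij: "i \<in> J" "j \<in> J" "v i = v j" "i \<noteq> j"
    let ?c = "\<lambda>k. (if k = i then 1 else 0) - (if k = j then 1 else (0::real))"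
    have "(\<Sum>k\<in>J. ?c k *\<^sub>R v k)
        = (\<Sum>k\<in>J. if k = i then v k else 0) - (\<Sum>k\<in>J. if k = j then v k else 0)"
      by (simp add: scaleR_left_diff_distrib sum_subtractf if_distrib [of "\<lambda>c. c *\<^sub>R _"] cong: if_cong)
    also have "\<dots> = 0"
      using ij assms by simp
    finally show False
      using c[rule_format, of ?c i] ij by simp
  qed
  have "independent (v ` J)"
  proof (rule independent_if_scalars_zero)
    fix u x assume "(\<Sum>x\<in>v ` J. u x *\<^sub>R x) = 0" "x \<in> v ` J"
    then show "u x = 0"
      using c[rule_format, of "\<lambda>i. u (v i)"] by (auto simp: sum.reindex[OF inj])
  qed (use assms in simp)
  with inj show "independent_family J v"
    by (simp add: independent_family_def)
qed

text \<open>In this form a rank condition can be read off: if the ranks of a family at two parameter values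
  agree, then independence at one of them transfers to the other.\<close>
lemma independent_family_dim:
  fixes v :: "'i \<Rightarrow> 'h::real_vector"
  assumes "finite J"
  shows "independent_family J v \<longleftrightarrow> dim (v ` J) = card J"
proof
  assume "independent_family J v"
  then show "dim (v ` J) = card J"
    by (simp add: independent_family_def dim_eq_card_independent card_image)
next
  assume dim: "dim (v ` J) = card J"
  obtain B where B: "B \<subseteq> v ` J" "independent B" "card B = dim (v ` J)"
    by (rule basis_exists)
  have "card (v ` J) \<le> card J"
    using assms by (rule card_image_le)
  moreover have "card B \<le> card (v ` J)"
    using B assms by (intro card_mono) auto
  ultimately have card: "card (v ` J) = card J" and "card B = card (v ` J)"
    using B(3) dim by linarith+
  then have "B = v ` J"
    using B(1) assms by (intro card_subset_eq) simp_all
  with B(2) have "independent (v ` J)"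
    by simp
  with eq_card_imp_inj_on[OF assms card] show "independent_family J v"
    by (simp add: independent_family_def)
qed

section \<open>Cone duality\<close>

text \<open>Farkas' lemma, in an inner product space of any dimension; the indices in \<open>E\<close> carry multipliers
  of either sign. The induction removes one generator \<open>v j\<close> at a time. If \<open>v j\<close> is needed at all, some
  \<open>e\<close> is feasible for the other generators but satisfies \<open>h \<bullet> e > 0\<close>; then \<open>v j \<bullet> e \<noteq> 0\<close>, and the
  projection along \<open>v j\<close> onto the orthogonal complement of \<open>e\<close> reduces the claim to the remaining
  generators. The multiplier of \<open>v j\<close> gets the right sign because \<open>h \<bullet> e\<close> is positive while every
  other generator contributes a nonpositive amount.\<close>
lemma farkas:
  fixes v :: "'i \<Rightarrow> 'h::real_inner"
  assumes "finite A"
    and "\<And>d. (\<And>i. i \<in> A \<Longrightarrow> v i \<bullet> d \<le> 0) \<Longrightarrow> (\<And>i. i \<in> A \<inter> E \<Longrightarrow> v i \<bullet> d = 0) \<Longrightarrow> h \<bullet> d \<le> 0"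
  shows "\<exists>c. h = (\<Sum>i\<in>A. c i *\<^sub>R v i) \<and> (\<forall>i\<in>A - E. 0 \<le> c i)"
  using assms
proof (induction A arbitrary: v h rule: finite_induct)
  case empty
  from empty[of h] have "h \<bullet> h \<le> 0"
    by simp
  then have "h = 0"
    by (metis inner_eq_zero_iff inner_ge_zero order_antisym)
  then show ?case by simp
next
  case (insert j A)
  show ?case
  proof (cases "\<forall>d. (\<forall>i\<in>A. v i \<bullet> d \<le> 0) \<longrightarrow> (\<forall>i\<in>A \<inter> E. v i \<bullet> d = 0) \<longrightarrow> h \<bullet> d \<le> 0")
    case True
    then obtain c where c: "h = (\<Sum>i\<in>A. c i *\<^sub>R v i)" "\<forall>i\<in>A - E. 0 \<le> c i"
      using insert.IH[of v h] by blast
    have "(\<Sum>i\<in>A. (c(j := 0)) i *\<^sub>R v i) = (\<Sum>i\<in>A. c i *\<^sub>R v i)"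
      using insert.hyps by (intro sum.cong) auto
    then show ?thesis
      using c insert.hyps by (intro exI[of _ "c(j := 0)"]) auto
  next
    case False
    then obtain e where "\<forall>i\<in>A. v i \<bullet> e \<le> 0" "\<forall>i\<in>A \<inter> E. v i \<bullet> e = 0" "h \<bullet> e > 0"
      by (auto simp: not_le)
    then have e: "\<And>i. i \<in> A \<Longrightarrow> v i \<bullet> e \<le> 0" "\<And>i. i \<in> A \<inter> E \<Longrightarrow> v i \<bullet> e = 0" "h \<bullet> e > 0"
      by auto
    define s where "s = v j \<bullet> e"
    have s: "s > 0 \<or> s \<noteq> 0 \<and> j \<in> E"
    proof (rule ccontr)
      assume "\<not> ?thesis"
      then have "v j \<bullet> e \<le> 0" "j \<in> E \<Longrightarrow> v j \<bullet> e = 0"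
        by (auto simp: s_def)
      then have "h \<bullet> e \<le> 0"
        using e by (intro insert.prems) auto
      then show False using e by simp
    qed
    \<comment> \<open>the projection along \<open>v j\<close> onto the orthogonal complement of \<open>e\<close>\<close>
    define pr where "pr u = u - ((u \<bullet> e) / s) *\<^sub>R v j" for u
    have "\<exists>c. pr h = (\<Sum>i\<in>A. c i *\<^sub>R pr (v i)) \<and> (\<forall>i\<in>A - E. 0 \<le> c i)"
    proof (rule insert.IH)
      fix d assume d: "\<And>i. i \<in> A \<Longrightarrow> pr (v i) \<bullet> d \<le> 0" "\<And>i. i \<in> A \<inter> E \<Longrightarrow> pr (v i) \<bullet> d = 0"
      \<comment> \<open>the adjoint of \<open>pr\<close> applied to \<open>d\<close>\<close>
      define d' where "d' = d - ((v j \<bullet> d) / s) *\<^sub>R e"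
      have adj: "pr u \<bullet> d = u \<bullet> d'" for u
        by (simp add: pr_def d'_def inner_diff_left inner_diff_right)
      have "v j \<bullet> d' = 0"
        using s by (auto simp: d'_def inner_diff_right s_def)
      then have "h \<bullet> d' \<le> 0"
        using d unfolding adj by (intro insert.prems) auto
      then show "pr h \<bullet> d \<le> 0" by (simp add: adj)
    qed
    then obtain c where c: "pr h = (\<Sum>i\<in>A. c i *\<^sub>R pr (v i))" "\<forall>i\<in>A - E. 0 \<le> c i"
      by blast
    define t where "t = (h \<bullet> e - (\<Sum>i\<in>A. c i * (v i \<bullet> e))) / s"
    have "c i * (v i \<bullet> e) \<le> 0" if "i \<in> A" for i
      using e(1,2)[of i] c(2) that by (cases "i \<in> E") (auto simp: mult_nonneg_nonpos)
    then have "(\<Sum>i\<in>A. c i * (v i \<bullet> e)) \<le> 0"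
      by (rule sum_nonpos)
    with e s have t: "j \<notin> E \<Longrightarrow> 0 \<le> t"
      by (auto simp: t_def)
    have "(\<Sum>i\<in>A. c i *\<^sub>R pr (v i))
        = (\<Sum>i\<in>A. c i *\<^sub>R v i) - ((\<Sum>i\<in>A. c i * (v i \<bullet> e)) / s) *\<^sub>R v j"
      by (simp add: pr_def scaleR_right_diff_distrib sum_subtractf sum_divide_distrib scaleR_sum_left)
    then have "h = (h \<bullet> e / s) *\<^sub>R v j + ((\<Sum>i\<in>A. c i *\<^sub>R v i)
        - ((\<Sum>i\<in>A. c i * (v i \<bullet> e)) / s) *\<^sub>R v j)"
      using c(1) by (metis pr_def add.commute diff_add_cancel)
    then have h: "h = t *\<^sub>R v j + (\<Sum>i\<in>A. c i *\<^sub>R v i)"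
      unfolding t_def diff_divide_distrib scaleR_left_diff_distrib by (simp add: algebra_simps)
    have "(\<Sum>i\<in>A. (c(j := t)) i *\<^sub>R v i) = (\<Sum>i\<in>A. c i *\<^sub>R v i)"
      using insert.hyps by (intro sum.cong) auto
    then show ?thesis
      using h c(2) t insert.hyps by (intro exI[of _ "c(j := t)"]) auto
  qed
qed

text \<open>A conic combination over a dependent family can be moved along a dependency relation until one of
  the sign-constrained coefficients vanishes. Since the family over \<open>E\<close> is itself independent, every
  dependency involves an index outside \<open>E\<close>, so all of \<open>E\<close> survives the reduction.\<close>
lemma conic_caratheodory:
  fixes v :: "'i \<Rightarrow> 'h::real_vector"
  assumes "finite A" "E \<subseteq> A" "independent_family E v"
    and "h = (\<Sum>i\<in>A. c i *\<^sub>R v i)" "\<forall>i\<in>A - E. 0 \<le> c i"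
  shows "\<exists>L c'. L \<subseteq> A - E \<and> independent_family (E \<union> L) v \<and>
           h = (\<Sum>i\<in>E \<union> L. c' i *\<^sub>R v i) \<and> (\<forall>i\<in>L. 0 < c' i)"
  using assms
proof (induction "card A" arbitrary: A c rule: less_induct)
  case less
  note fin = less.prems(1)
  have drop: ?case
    if m: "m \<in> A - E" and b: "h = (\<Sum>i\<in>A. b i *\<^sub>R v i)" "\<forall>i\<in>A - E. 0 \<le> b i" "b m = 0" for m b
  proof -
    have "h = (\<Sum>i\<in>A - {m}. b i *\<^sub>R v i)"
      using sum.remove[OF fin, of m "\<lambda>i. b i *\<^sub>R v i"] m b by simp
    moreover have "card (A - {m}) < card A"
      using m fin by (meson DiffD1 card_Diff1_less)
    ultimately have "\<exists>L c'. L \<subseteq> (A - {m}) - E \<and> independent_family (E \<union> L) v \<and>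
           h = (\<Sum>i\<in>E \<union> L. c' i *\<^sub>R v i) \<and> (\<forall>i\<in>L. 0 < c' i)"
      using less.prems m b by (intro less.hyps) auto
    then show ?thesis by blast
  qed
  consider (zero) m where "m \<in> A - E" "c m = 0"
    | (indep) "independent_family A v" "\<forall>i\<in>A - E. 0 < c i"
    | (dep) "\<not> independent_family A v" "\<forall>i\<in>A - E. 0 < c i"
    using less.prems(5) by (metis order_less_le)
  then show ?case
  proof cases
    case zero
    then show ?thesis using drop less.prems by blast
  next
    case indep
    have "E \<union> (A - E) = A" using less.prems by blast
    with indep less.prems show ?thesis
      by (intro exI[of _ "A - E"] exI[of _ c]) auto
  next
    case dep
    obtain b0 k0 where b0: "(\<Sum>i\<in>A. b0 i *\<^sub>R v i) = 0" "k0 \<in> A" "b0 k0 \<noteq> 0"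
      using dep(1) unfolding independent_family_iff[OF fin] by blast
    have "\<exists>k\<in>A - E. b0 k \<noteq> 0"
    proof (rule ccontr)
      assume *: "\<not> ?thesis"
      have "(\<Sum>i\<in>E. b0 i *\<^sub>R v i) = (\<Sum>i\<in>A. b0 i *\<^sub>R v i)"
        using * less.prems by (intro sum.mono_neutral_left) auto
      then have "\<forall>i\<in>E. b0 i = 0"
        using less.prems b0 independent_family_iff[of E v] finite_subset by metis
      with * b0 show False by blast
    qed
    then obtain k where k: "k \<in> A - E" "b0 k \<noteq> 0" by blast
    \<comment> \<open>the sign of the dependency is chosen so that it decreases some constrained coefficient\<close>
    define b where "b i = sgn (b0 k) * b0 i" for i
    have b: "(\<Sum>i\<in>A. b i *\<^sub>R v i) = 0" "b k > 0"
      using b0 k by (auto simp: b_def sgn_if simp flip: scaleR_scaleR scaleR_sum_right)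
    define P where "P = {i \<in> A - E. b i > 0}"
    have "finite P" "P \<noteq> {}"
      using fin k b by (auto simp: P_def)
    then have "Min ((\<lambda>i. c i / b i) ` P) \<in> (\<lambda>i. c i / b i) ` P"
      by (intro Min_in) auto
    then obtain m where m: "m \<in> P" and Min: "c m / b m = Min ((\<lambda>i. c i / b i) ` P)"
      by (elim imageE) simp
    have min: "c m / b m \<le> c i / b i" if "i \<in> P" for i
      unfolding Min using \<open>finite P\<close> that by (intro Min_le) auto
    \<comment> \<open>the largest step that keeps all constrained coefficients nonnegative; it annihilates the coefficient of \<open>m\<close>\<close>
    define t where "t = c m / b m"
    have t: "t > 0" using m dep by (auto simp: t_def P_def)
    have "t * b i \<le> c i" if "i \<in> A - E" for i
    proof (cases "b i > 0")
      case True
      then show ?thesis using min[of i] that by (simp add: P_def t_def pos_le_divide_eq)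
    next
      case False
      then have "t * b i \<le> 0" using t by (simp add: mult_nonneg_nonpos)
      also have "0 < c i" using dep that by blast
      finally show ?thesis by simp
    qed
    then have "\<forall>i\<in>A - E. 0 \<le> c i - t * b i"
      by simp
    moreover have "h = (\<Sum>i\<in>A. (c i - t * b i) *\<^sub>R v i)"
      using b less.prems(4)
      by (simp add: scaleR_left_diff_distrib sum_subtractf flip: scaleR_scaleR scaleR_sum_right)
    moreover have "m \<in> A - E" "c m - t * b m = 0"
      using m by (simp_all add: P_def t_def)
    ultimately show ?thesis
      using drop[of m "\<lambda>i. c i - t * b i"] by blast
  qed
qed

text \<open>If every \<open>d\<close> orthogonal to the other members were orthogonal to \<open>v i\<close> as well, Farkas' lemma with
  unrestricted signs would place \<open>v i\<close> in their span.\<close>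
lemma dual_vector:
  fixes v :: "'i \<Rightarrow> 'h::real_inner"
  assumes "finite J" "independent_family J v" "i \<in> J"
  shows "\<exists>d. v i \<bullet> d = 1 \<and> (\<forall>j\<in>J - {i}. v j \<bullet> d = 0)"
proof (rule ccontr)
  assume no: "\<not> ?thesis"
  have "\<exists>c. v i = (\<Sum>j\<in>J - {i}. c j *\<^sub>R v j) \<and> (\<forall>j\<in>(J - {i}) - J. 0 \<le> c j)"
  proof (rule farkas)
    fix d assume d: "\<And>j. j \<in> (J - {i}) \<inter> J \<Longrightarrow> v j \<bullet> d = 0"
    have "v i \<bullet> d = 0"
    proof (rule ccontr)
      assume "v i \<bullet> d \<noteq> 0"
      then have "v i \<bullet> (d /\<^sub>R (v i \<bullet> d)) = 1 \<and> (\<forall>j\<in>J - {i}. v j \<bullet> (d /\<^sub>R (v i \<bullet> d)) = 0)"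
        using d by simp
      with no show False by blast
    qed
    then show "v i \<bullet> d \<le> 0" by simp
  qed (use assms in simp)
  then obtain c where c: "v i = (\<Sum>j\<in>J - {i}. c j *\<^sub>R v j)" by blast
  have "(\<Sum>j\<in>J - {i}. (c(i := -1)) j *\<^sub>R v j) = (\<Sum>j\<in>J - {i}. c j *\<^sub>R v j)"
    by (intro sum.cong) auto
  then have "(\<Sum>j\<in>J. (c(i := -1)) j *\<^sub>R v j) = 0"
    using c unfolding sum.remove[OF assms(1,3)] by simp
  then have "(c(i := -1)) i = 0"
    using assms independent_family_iff[of J v] by blast
  then show False by simp
qed

text \<open>Pairing a combination with the dual vectors recovers its coefficients, so the norms of the dual
  vectors bound the coefficients by the norm of the combination.\<close>
lemma independent_family_coefficient_bound:
  fixes v :: "'i \<Rightarrow> 'h::real_inner"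
  assumes "finite J" "independent_family J v"
  shows "\<exists>M>0. \<forall>c. (\<Sum>i\<in>J. \<bar>c i\<bar>) \<le> M * norm (\<Sum>i\<in>J. c i *\<^sub>R v i)"
proof -
  have "\<forall>i\<in>J. \<exists>d. v i \<bullet> d = 1 \<and> (\<forall>j\<in>J - {i}. v j \<bullet> d = 0)"
    by (intro ballI dual_vector assms)
  then obtain d where "\<forall>i\<in>J. v i \<bullet> d i = 1 \<and> (\<forall>j\<in>J - {i}. v j \<bullet> d i = 0)"
    using bchoice[of J "\<lambda>i d. v i \<bullet> d = 1 \<and> (\<forall>j\<in>J - {i}. v j \<bullet> d = 0)"] by blast
  then have d: "\<And>i. i \<in> J \<Longrightarrow> v i \<bullet> d i = 1" "\<And>i j. i \<in> J \<Longrightarrow> j \<in> J - {i} \<Longrightarrow> v j \<bullet> d i = 0"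
    by blast+
  define M where "M = 1 + (\<Sum>i\<in>J. norm (d i))"
  have "M > 0" unfolding M_def by (intro add_pos_nonneg sum_nonneg) auto
  moreover have "(\<Sum>i\<in>J. \<bar>c i\<bar>) \<le> M * norm (\<Sum>i\<in>J. c i *\<^sub>R v i)" for c
  proof -
    let ?s = "\<Sum>i\<in>J. c i *\<^sub>R v i"
    have "\<bar>c i\<bar> \<le> norm (d i) * norm ?s" if "i \<in> J" for i
    proof -
      have "?s \<bullet> d i = c i * (v i \<bullet> d i) + (\<Sum>j\<in>J - {i}. c j * (v j \<bullet> d i))"
        unfolding sum.remove[OF assms(1) that] by (simp add: inner_sum_left inner_add_left)
      also have "\<dots> = c i"
        using d that by simp
      finally have "c i = ?s \<bullet> d i" ..
      then show ?thesis
        using Cauchy_Schwarz_ineq2[of ?s "d i"] by (simp add: mult.commute)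
    qed
    then have "(\<Sum>i\<in>J. \<bar>c i\<bar>) \<le> (\<Sum>i\<in>J. norm (d i) * norm ?s)"
      by (rule sum_mono)
    also have "\<dots> \<le> M * norm ?s"
      by (simp add: M_def sum_distrib_right distrib_right)
    finally show ?thesis .
  qed
  ultimately show ?thesis by blast
qed

section \<open>Projection onto a closed convex set\<close>

text \<open>By the parallelogram identity a minimising sequence is Cauchy: the midpoint of two almost optimal
  points lies in the set and cannot be better than optimal. Completeness replaces compactness.\<close>
lemma Hilbert_projection:
  fixes S :: "'h::{real_inner, complete_space} set"
  assumes "closed S" "convex S" "S \<noteq> {}"
  shows "\<exists>z\<in>S. x - z \<in> normal_cone z S \<and> (\<forall>y\<in>S. norm (x - z) \<le> norm (x - y))"
proof -
  define \<delta> where "\<delta> = (INF y\<in>S. (norm (x - y))\<^sup>2)"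
  have bdd: "bdd_below ((\<lambda>y. (norm (x - y))\<^sup>2) ` S)"
    by (intro bdd_belowI2[of _ 0]) simp
  have le: "\<delta> \<le> (norm (x - y))\<^sup>2" if "y \<in> S" for y
    unfolding \<delta>_def using bdd that by (rule cINF_lower)
  have "\<exists>y. y \<in> S \<and> (norm (x - y))\<^sup>2 < \<delta> + inverse (real (Suc n))" for n
    using cINF_less_iff[OF assms(3) bdd, of "\<delta> + inverse (real (Suc n))"] by (auto simp: \<delta>_def)
  then obtain y where y: "\<And>n. y n \<in> S" "\<And>n. (norm (x - y n))\<^sup>2 < \<delta> + inverse (real (Suc n))"
    using choice[of "\<lambda>n y. y \<in> S \<and> (norm (x - y))\<^sup>2 < \<delta> + inverse (real (Suc n))"] by blast
  have close: "(norm (y m - y n))\<^sup>2 \<le> 4 * inverse (real (Suc N))" if "m \<ge> N" "n \<ge> N" for m n N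
  proof -
    have "midpoint (y m) (y n) \<in> S"
      using assms(2) y(1) by (simp add: midpoint_def convexD scaleR_right_distrib)
    then have "\<delta> \<le> (norm (x - midpoint (y m) (y n)))\<^sup>2"
      by (rule le)
    moreover have "(norm (y m - y n))\<^sup>2 + 4 * (norm (x - midpoint (y m) (y n)))\<^sup>2
        = 2 * (norm (x - y m))\<^sup>2 + 2 * (norm (x - y n))\<^sup>2"
      by (simp add: midpoint_def power2_norm_eq_inner algebra_simps inner_commute)
    moreover have "inverse (real (Suc m)) \<le> inverse (real (Suc N))" "inverse (real (Suc n)) \<le> inverse (real (Suc N))"
      using that by simp_all
    ultimately show ?thesis
      using y(2)[of m] y(2)[of n] by linarith
  qed
  have "Cauchy y"
  proof (rule metric_CauchyI)
    fix e :: real assume "e > 0"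
    then obtain N where "inverse (real (Suc N)) < (e/2)\<^sup>2"
      using reals_Archimedean[of "(e/2)\<^sup>2"] by auto
    then have "(norm (y m - y n))\<^sup>2 < e\<^sup>2" if "m \<ge> N" "n \<ge> N" for m n
      using close[OF that] by (simp add: power_divide)
    then have "norm (y m - y n) < e" if "m \<ge> N" "n \<ge> N" for m n
      using that \<open>e > 0\<close> by (intro power_less_imp_less_base[of _ 2 e]) auto
    then show "\<exists>M. \<forall>m\<ge>M. \<forall>n\<ge>M. dist (y m) (y n) < e"
      by (auto simp: dist_norm)
  qed
  then obtain z where z: "y \<longlonglongrightarrow> z"
    using Cauchy_convergent[of y] unfolding convergent_def by blast
  have zS: "z \<in> S"
    using assms(1) y(1) z by (rule closed_sequentially)
  have "(\<lambda>n. (norm (x - y n))\<^sup>2) \<longlonglongrightarrow> (norm (x - z))\<^sup>2"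
    by (intro tendsto_intros z)
  moreover have "(\<lambda>n. \<delta> + inverse (real (Suc n))) \<longlonglongrightarrow> \<delta> + 0"
    by (intro tendsto_intros LIMSEQ_inverse_real_of_nat)
  ultimately have "(norm (x - z))\<^sup>2 \<le> \<delta> + 0"
    by (rule LIMSEQ_le) (use y(2) in \<open>auto intro!: exI[of _ 0] less_imp_le\<close>)
  have zle: "norm (x - z) \<le> norm (x - y)" if "y \<in> S" for y
  proof (rule power2_le_imp_le)
    show "(norm (x - z))\<^sup>2 \<le> (norm (x - y))\<^sup>2"
      using \<open>(norm (x - z))\<^sup>2 \<le> \<delta> + 0\<close> le[OF that] by linarith
  qed simp
  have "(x - z) \<bullet> (y - z) \<le> 0" if "y \<in> S" for y
    by (rule any_closest_point_dot[OF assms(2,1) zS that]) (simp add: dist_norm zle)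
  then have "x - z \<in> normal_cone z S"
    by (simp add: normal_cone_def)
  with zS zle show ?thesis
    by blast
qed

section \<open>Systems of equations and inequalities\<close>

lemma active_indices_tightened:
  "K \<subseteq> I \<Longrightarrow> active_indices (E \<union> K) (I - K) g f p x = active_indices E I g f p x"
  by (auto simp: active_indices_def)

lemma equations_active:
  "x \<in> solution_set E I g f p \<Longrightarrow> E \<subseteq> active_indices E I g f p x"
  by (auto simp: solution_set_def active_indices_def)

lemma tightened_subset_solution_set:
  "K \<subseteq> I \<Longrightarrow> solution_set (E \<union> K) (I - K) g f p \<subseteq> solution_set E I g f p"
proof (clarsimp simp: solution_set_def)
  fix x i assume "\<forall>i\<in>E \<union> K. x \<bullet> g i p = f i p" "\<forall>i\<in>I - K. x \<bullet> g i p \<le> f i p" "i \<in> I"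
  then show "x \<bullet> g i p \<le> f i p" by (cases "i \<in> K") auto
qed

lemma closed_solution_set: "closed (solution_set E I g f p)"
proof -
  have "solution_set E I g f p
      = (\<Inter>i\<in>E. {x. x \<bullet> g i p = f i p}) \<inter> (\<Inter>i\<in>I. {x. x \<bullet> g i p \<le> f i p})"
    by (auto simp: solution_set_def)
  moreover have "closed {x. x \<bullet> g i p = f i p}" "closed {x. x \<bullet> g i p \<le> f i p}" for i
    by (intro closed_Collect_eq closed_Collect_le continuous_intros)+
  ultimately show ?thesis
    by (simp add: closed_INT closed_Int)
qed

lemma convex_solution_set: "convex (solution_set E I g f p)"
proof (rule convexI)
  fix x y and u v :: real
  assume x: "x \<in> solution_set E I g f p" and y: "y \<in> solution_set E I g f p"
    and uv: "0 \<le> u" "0 \<le> v" "u + v = 1"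
  have 1: "u * (x \<bullet> g i p) + v * (y \<bullet> g i p) = f i p" if "i \<in> E" for i
    using x y that uv(3) by (simp add: solution_set_def flip: distrib_right)
  have 2: "u * (x \<bullet> g i p) + v * (y \<bullet> g i p) \<le> f i p" if "i \<in> I" for i
    using x y that uv by (intro convex_bound_le) (auto simp: solution_set_def)
  show "u *\<^sub>R x + v *\<^sub>R y \<in> solution_set E I g f p"
    using 1 2 by (simp add: solution_set_def inner_add_left)
qed

text \<open>If \<open>d\<close> satisfies the linearised active constraints, a short step from \<open>x\<close> along \<open>d\<close> stays in the
  solution set, because the finitely many inactive constraints have slack. Hence \<open>h \<bullet> d \<le> 0\<close> for all
  such \<open>d\<close>, and Farkas' lemma applies; the conic reduction then selects an independent family.\<close>
lemma normal_cone_multipliers: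
  assumes "finite (E \<union> I)" "E \<inter> I = {}" "independent_family E (\<lambda>i. g i p)"
    and x: "x \<in> solution_set E I g f p" and h: "h \<in> normal_cone x (solution_set E I g f p)"
  obtains L c where "L \<subseteq> active_indices E I g f p x \<inter> I" "independent_family (E \<union> L) (\<lambda>i. g i p)"
    "h = (\<Sum>i\<in>E \<union> L. c i *\<^sub>R g i p)" "\<forall>i\<in>L. 0 < c i"
proof -
  let ?A = "active_indices E I g f p x"
  have fin: "finite ?A" using assms(1) by (simp add: active_indices_def)
  have E: "E \<subseteq> ?A" by (rule equations_active[OF x])
  have "\<exists>c. h = (\<Sum>i\<in>?A. c i *\<^sub>R g i p) \<and> (\<forall>i\<in>?A - E. 0 \<le> c i)"
  proof (rule farkas[OF fin])
    fix d assume d: "\<And>i. i \<in> ?A \<Longrightarrow> g i p \<bullet> d \<le> 0" "\<And>i. i \<in> ?A \<inter> E \<Longrightarrow> g i p \<bullet> d = 0"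
    have "\<forall>\<^sub>F t in at_right 0. t * (g i p \<bullet> d) < f i p - x \<bullet> g i p" if "i \<in> I - ?A" for i
    proof (rule order_tendstoD)
      show "((\<lambda>t. t * (g i p \<bullet> d)) \<longlongrightarrow> 0 * (g i p \<bullet> d)) (at_right 0)"
        by (intro tendsto_intros)
      show "0 * (g i p \<bullet> d) < f i p - x \<bullet> g i p"
        using x that by (force simp: solution_set_def active_indices_def)
    qed
    then have "\<forall>\<^sub>F t in at_right 0. \<forall>i\<in>I - ?A. t * (g i p \<bullet> d) < f i p - x \<bullet> g i p"
      using assms(1) by (intro eventually_ball_finite) auto
    then have "\<forall>\<^sub>F t in at_right 0. 0 < t \<and> (\<forall>i\<in>I - ?A. t * (g i p \<bullet> d) < f i p - x \<bullet> g i p)"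
      by (intro eventually_conj eventually_at_right_less)
    then obtain t :: real where t: "t > 0" "\<forall>i\<in>I - ?A. t * (g i p \<bullet> d) < f i p - x \<bullet> g i p"
      using eventually_happens'[OF trivial_limit_at_right_real] by blast
    have inner: "(x + t *\<^sub>R d) \<bullet> g i p = x \<bullet> g i p + t * (g i p \<bullet> d)" for i
      by (simp add: inner_add_left inner_commute[of d])
    have "x \<bullet> g i p + t * (g i p \<bullet> d) \<le> f i p" if "i \<in> I" for i
    proof (cases "i \<in> ?A")
      case True
      then have "t * (g i p \<bullet> d) \<le> 0" using d(1) t(1) by (simp add: mult_nonneg_nonpos)
      with True show ?thesis by (simp add: active_indices_def)
    next
      case False
      then show ?thesis using t(2)[rule_format, of i] that by simp
    qed
    moreover have "x \<bullet> g i p + t * (g i p \<bullet> d) = f i p" if "i \<in> E" for i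
      using d(2)[of i] E that x by (auto simp: solution_set_def)
    ultimately have "x + t *\<^sub>R d \<in> solution_set E I g f p"
      by (simp add: solution_set_def inner)
    then have "h \<bullet> ((x + t *\<^sub>R d) - x) \<le> 0"
      using h by (simp only: normal_cone_def mem_Collect_eq)
    then show "h \<bullet> d \<le> 0"
      using t(1) by (simp add: mult_le_0_iff)
  qed
  then obtain c where c: "h = (\<Sum>i\<in>?A. c i *\<^sub>R g i p)" "\<forall>i\<in>?A - E. 0 \<le> c i"
    by blast
  obtain L c' where L: "L \<subseteq> ?A - E" "independent_family (E \<union> L) (\<lambda>i. g i p)"
    "h = (\<Sum>i\<in>E \<union> L. c' i *\<^sub>R g i p)" "\<forall>i\<in>L. 0 < c' i"
    using conic_caratheodory[OF fin E assms(3) c] by blast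
  moreover have "L \<subseteq> ?A \<inter> I"
    using L(1) by (auto simp: active_indices_def)
  ultimately show ?thesis
    using that by blast
qed

section \<open>Limits relative to the parameter set\<close>

text \<open>The neighbourhoods of \<open>p\<close> relative to \<open>D\<close>, with \<open>p\<close> itself included, unlike in the filter
  \<open>at p within D\<close>.\<close>
abbreviation nhds_in :: "'p::topological_space set \<Rightarrow> 'p \<Rightarrow> 'p filter" where
  "nhds_in D p \<equiv> inf (nhds p) (principal D)"

lemma eventually_nhds_in_metric:
  "eventually P (nhds_in D p) \<longleftrightarrow> (\<exists>d>0. \<forall>q\<in>D. dist q p < d \<longrightarrow> P q)"
  by (auto simp: eventually_inf_principal eventually_nhds_metric)

lemma eventually_nhds_in_openin:
  "p \<in> D \<Longrightarrow> eventually P (nhds_in D p) \<longleftrightarrow>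
    (\<exists>U. openin (top_of_set D) U \<and> p \<in> U \<and> (\<forall>q\<in>U. P q))"
  by (auto simp: eventually_inf_principal eventually_nhds openin_open)

text \<open>The sequential definition yields a uniform statement: otherwise parameters tending to \<open>p\<close> could be
  chosen whose values all stay at distance at least \<open>e\<close> from \<open>y\<close>.\<close>
lemma lower_kuratowski_limit_eventually:
  fixes p :: "'p::metric_space" and y :: "'h::metric_space"
  assumes "y \<in> lower_kuratowski_limit D p F" "e > 0"
  shows "\<forall>\<^sub>F q in nhds_in D p. \<exists>z\<in>F q. dist z y < e"
proof (rule ccontr)
  assume *: "\<not> ?thesis"
  have "\<exists>q. q \<in> D \<and> dist q p < inverse (real (Suc n)) \<and> (\<forall>z\<in>F q. \<not> dist z y < e)" for n
    using *[unfolded eventually_nhds_in_metric not_ex, THEN spec, of "inverse (real (Suc n))"]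
    by (simp del: of_nat_Suc) blast
  then obtain ps where ps: "\<And>n. ps n \<in> D" "\<And>n. dist (ps n) p < inverse (real (Suc n))"
    "\<And>n z. z \<in> F (ps n) \<Longrightarrow> \<not> dist z y < e"
    using choice[of "\<lambda>n q. q \<in> D \<and> dist q p < inverse (real (Suc n)) \<and> (\<forall>z\<in>F q. \<not> dist z y < e)"]
    by blast
  have "(\<lambda>n. dist (ps n) p) \<longlonglongrightarrow> 0"
  proof (rule tendsto_sandwich[OF _ _ tendsto_const LIMSEQ_inverse_real_of_nat])
    show "\<forall>\<^sub>F n in sequentially. dist (ps n) p \<le> inverse (real (Suc n))"
      by (intro always_eventually allI less_imp_le ps(2))
  qed simp
  then have "ps \<longlonglongrightarrow> p"
    by (rule tendsto_dist_iff[THEN iffD2])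
  then obtain ys where ys: "\<And>k. ys k \<in> F (ps k)" "ys \<longlonglongrightarrow> y"
    using assms(1) ps(1) unfolding lower_kuratowski_limit_def by blast
  have "\<forall>\<^sub>F k in sequentially. dist (ys k) y < e"
    using ys(2) assms(2) by (rule tendstoD)
  then obtain k where "dist (ys k) y < e"
    using eventually_happens'[OF sequentially_bot] by blast
  with ps(3)[OF ys(1)] show False by blast
qed

lemma locally_lipschitz_on_eventually:
  assumes "locally_lipschitz_on D h" "p \<in> D"
  shows "\<exists>L. \<forall>\<^sub>F z in nhds_in D p \<times>\<^sub>F nhds_in D p. dist (h (fst z)) (h (snd z)) \<le> L * dist (fst z) (snd z)"
proof -
  obtain u L where uL: "u > 0" "L-lipschitz_on (ball p u \<inter> D) h"
    using assms by (auto simp: locally_lipschitz_on_def)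
  have ev: "\<forall>\<^sub>F q in nhds_in D p. q \<in> ball p u \<inter> D"
    using uL(1) by (auto simp: eventually_nhds_in_metric dist_commute)
  have "\<forall>\<^sub>F z in nhds_in D p \<times>\<^sub>F nhds_in D p. dist (h (fst z)) (h (snd z)) \<le> L * dist (fst z) (snd z)"
    using eventually_prodI[OF ev ev] by (rule eventually_mono) (auto intro!: lipschitz_onD[OF uL(2)])
  then show ?thesis ..
qed

lemma locally_lipschitz_on_tendsto:
  assumes "locally_lipschitz_on D h" "p \<in> D"
  shows "(h \<longlongrightarrow> h p) (nhds_in D p)"
proof -
  obtain u L where uL: "u > 0" "L-lipschitz_on (ball p u \<inter> D) h"
    using assms by (auto simp: locally_lipschitz_on_def)
  have ev: "\<forall>\<^sub>F q in nhds_in D p. q \<in> ball p u \<inter> D"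
    using uL(1) by (auto simp: eventually_nhds_in_metric dist_commute)
  have "((\<lambda>q. L * dist q p) \<longlongrightarrow> L * dist p p) (nhds_in D p)"
    by (intro tendsto_intros tendsto_mono[OF inf_le1] filterlim_ident)
  then have lim: "((\<lambda>q. L * dist q p) \<longlongrightarrow> 0) (nhds_in D p)"
    by simp
  have "((\<lambda>q. dist (h q) (h p)) \<longlongrightarrow> 0) (nhds_in D p)"
  proof (rule tendsto_sandwich[OF _ _ tendsto_const lim])
    show "\<forall>\<^sub>F q in nhds_in D p. dist (h q) (h p) \<le> L * dist q p"
      using ev by (rule eventually_mono) (use uL assms in \<open>auto intro!: lipschitz_onD[OF uL(2)]\<close>)
  qed simp
  then show ?thesis
    by (rule tendsto_dist_iff[THEN iffD2])
qed

text \<open>Only finitely many index sets occur, so constants that depend on the index set can be merged.\<close>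
lemma eventually_uniform_constant:
  fixes Q :: "'a \<Rightarrow> real \<Rightarrow> 'b \<Rightarrow> bool"
  assumes "finite A" "\<And>a. a \<in> A \<Longrightarrow> \<exists>M. \<forall>\<^sub>F z in F. Q a M z"
    and mono: "\<And>a M M' z. a \<in> A \<Longrightarrow> Q a M z \<Longrightarrow> M \<le> M' \<Longrightarrow> Q a M' z"
  shows "\<exists>M>0. \<forall>\<^sub>F z in F. \<forall>a\<in>A. Q a M z"
proof -
  obtain m where m: "\<And>a. a \<in> A \<Longrightarrow> \<forall>\<^sub>F z in F. Q a (m a) z"
    using bchoice[of A "\<lambda>a M. \<forall>\<^sub>F z in F. Q a M z"] assms(2) by blast
  define M where "M = 1 + (\<Sum>a\<in>A. \<bar>m a\<bar>)"
  have le: "m a \<le> M" if "a \<in> A" for a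
    using member_le_sum[OF that, of "\<lambda>a. \<bar>m a\<bar>"] assms(1) by (simp add: M_def)
  have "\<forall>\<^sub>F z in F. Q a M z" if "a \<in> A" for a
    using m[OF that] by (rule eventually_mono) (rule mono[OF that _ le[OF that]])
  then have "\<forall>\<^sub>F z in F. \<forall>a\<in>A. Q a M z"
    using assms(1) by (intro eventually_ball_finite) blast+
  moreover have "M > 0"
    unfolding M_def by (intro add_pos_nonneg sum_nonneg) auto
  ultimately show ?thesis by blast
qed

section \<open>Uniform bounds near the reference parameter\<close>

text \<open>Moving the vectors by at most \<open>1 / (2 * M)\<close> changes a combination by at most
  \<open>1 / (2 * M)\<close> times the sum of its absolute coefficients, so the bound survives with twice the
  constant.\<close>
lemma independent_family_coefficient_bound_nearby:
  fixes g :: "'i \<Rightarrow> 'p \<Rightarrow> 'h::real_inner"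
  assumes "finite J" "independent_family J (\<lambda>i. g i p)" "\<And>i. i \<in> J \<Longrightarrow> (g i \<longlongrightarrow> g i p) F"
  shows "\<exists>M. \<forall>\<^sub>F q in F. \<forall>c. (\<Sum>i\<in>J. \<bar>c i\<bar>) \<le> M * norm (\<Sum>i\<in>J. c i *\<^sub>R g i q)"
proof -
  obtain M where M: "M > 0" "\<And>c. (\<Sum>i\<in>J. \<bar>c i\<bar>) \<le> M * norm (\<Sum>i\<in>J. c i *\<^sub>R g i p)"
    using independent_family_coefficient_bound[OF assms(1,2)] by blast
  have "\<forall>i\<in>J. \<forall>\<^sub>F q in F. dist (g i q) (g i p) < 1 / (2 * M)"
    using assms(3) M(1) by (intro ballI tendstoD) auto
  then have "\<forall>\<^sub>F q in F. \<forall>i\<in>J. dist (g i q) (g i p) < 1 / (2 * M)"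
    by (rule eventually_ball_finite[OF assms(1)])
  then have "\<forall>\<^sub>F q in F. \<forall>c. (\<Sum>i\<in>J. \<bar>c i\<bar>) \<le> (2 * M) * norm (\<Sum>i\<in>J. c i *\<^sub>R g i q)"
  proof (rule eventually_mono, intro allI)
    fix q and c :: "'i \<Rightarrow> real" assume q: "\<forall>i\<in>J. dist (g i q) (g i p) < 1 / (2 * M)"
    let ?s = "\<Sum>i\<in>J. \<bar>c i\<bar>"
    have "(\<Sum>i\<in>J. c i *\<^sub>R g i p) = (\<Sum>i\<in>J. c i *\<^sub>R g i q) - (\<Sum>i\<in>J. c i *\<^sub>R (g i q - g i p))"
      by (simp add: scaleR_right_diff_distrib sum_subtractf)
    then have "norm (\<Sum>i\<in>J. c i *\<^sub>R g i p)
        \<le> norm (\<Sum>i\<in>J. c i *\<^sub>R g i q) + norm (\<Sum>i\<in>J. c i *\<^sub>R (g i q - g i p))"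
      by (simp add: norm_triangle_ineq4)
    also have "norm (\<Sum>i\<in>J. c i *\<^sub>R (g i q - g i p)) \<le> (\<Sum>i\<in>J. \<bar>c i\<bar> * (1 / (2 * M)))"
    proof (rule sum_norm_le)
      fix i assume "i \<in> J"
      then have "norm (g i q - g i p) \<le> 1 / (2 * M)"
        using q by (auto simp: dist_norm less_imp_le)
      then show "norm (c i *\<^sub>R (g i q - g i p)) \<le> \<bar>c i\<bar> * (1 / (2 * M))"
        by (simp only: norm_scaleR mult_left_mono abs_ge_zero)
    qed
    also have "\<dots> = ?s / (2 * M)"
      by (simp add: sum_divide_distrib)
    finally have "M * norm (\<Sum>i\<in>J. c i *\<^sub>R g i p) \<le> M * (norm (\<Sum>i\<in>J. c i *\<^sub>R g i q) + ?s / (2 * M))"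
      using M(1) by (intro mult_left_mono) auto
    also have "\<dots> = M * norm (\<Sum>i\<in>J. c i *\<^sub>R g i q) + ?s / 2"
      using M(1) by (simp add: distrib_left)
    finally show "?s \<le> (2 * M) * norm (\<Sum>i\<in>J. c i *\<^sub>R g i q)"
      using M(2)[of c] by linarith
  qed
  then show ?thesis ..
qed

lemma uniform_coefficient_bound:
  fixes g :: "'i \<Rightarrow> 'p \<Rightarrow> 'h::real_inner"
  assumes "finite B" "\<forall>i\<in>B. (g i \<longlongrightarrow> g i p) F"
  shows "\<exists>M>0. \<forall>\<^sub>F q in F. \<forall>J\<in>{J. J \<subseteq> B \<and> independent_family J (\<lambda>i. g i p)}.
           \<forall>c. (\<Sum>i\<in>J. \<bar>c i\<bar>) \<le> M * norm (\<Sum>i\<in>J. c i *\<^sub>R g i q)"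
proof (rule eventually_uniform_constant)
  show "finite {J. J \<subseteq> B \<and> independent_family J (\<lambda>i. g i p)}"
    using assms(1) by simp
  fix J assume "J \<in> {J. J \<subseteq> B \<and> independent_family J (\<lambda>i. g i p)}"
  then show "\<exists>M. \<forall>\<^sub>F q in F. \<forall>c. (\<Sum>i\<in>J. \<bar>c i\<bar>) \<le> M * norm (\<Sum>i\<in>J. c i *\<^sub>R g i q)"
    using assms finite_subset[of J B]
    by (intro independent_family_coefficient_bound_nearby) auto
next
  fix J M M' q
  assume "\<forall>c. (\<Sum>i\<in>J. \<bar>c i\<bar>) \<le> M * norm (\<Sum>i\<in>J. c i *\<^sub>R g i q)" and M: "M \<le> M'"
  then show "\<forall>c. (\<Sum>i\<in>J. \<bar>c i\<bar>) \<le> M' * norm (\<Sum>i\<in>J. c i *\<^sub>R g i q)"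
    by (meson mult_right_mono norm_ge_zero order_trans)
qed

lemma independent_family_if_coefficient_bound:
  assumes "finite J" "\<And>c. (\<Sum>i\<in>J. \<bar>c i\<bar>) \<le> M * norm (\<Sum>i\<in>J. c i *\<^sub>R v i)"
  shows "independent_family J v"
  unfolding independent_family_iff[OF assms(1)]
proof (intro allI impI)
  fix c assume "(\<Sum>i\<in>J. c i *\<^sub>R v i) = 0"
  then have "(\<Sum>i\<in>J. \<bar>c i\<bar>) \<le> 0"
    using assms(2)[of c] by simp
  then have "(\<Sum>i\<in>J. \<bar>c i\<bar>) = 0"
    by (intro order_antisym sum_nonneg) auto
  then show "\<forall>i\<in>J. c i = 0"
    using assms(1) by (simp add: sum_nonneg_eq_0_iff)
qed

text \<open>The residual of an inactive constraint is nonzero and depends continuously on parameter and point.\<close>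
lemma active_indices_nearby:
  fixes g :: "'i \<Rightarrow> 'p \<Rightarrow> 'h::real_inner"
  assumes "finite (E \<union> I)"
    and g: "\<forall>i\<in>E \<union> I. (g i \<longlongrightarrow> g i p) F" and f: "\<forall>i\<in>E \<union> I. (f i \<longlongrightarrow> f i p) F"
  shows "\<forall>\<^sub>F z in F \<times>\<^sub>F nhds xbar.
           active_indices E I g f (fst z) (snd z) \<subseteq> active_indices E I g f p xbar"
proof -
  let ?A = "active_indices E I g f p xbar"
  have "\<forall>\<^sub>F z in F \<times>\<^sub>F nhds xbar. snd z \<bullet> g i (fst z) - f i (fst z) \<noteq> 0" if i: "i \<in> E \<union> I - ?A" for i
  proof (rule tendsto_imp_eventually_ne)
    have "((\<lambda>z. g i (fst z)) \<longlongrightarrow> g i p) (F \<times>\<^sub>F nhds xbar)" "((\<lambda>z. f i (fst z)) \<longlongrightarrow> f i p) (F \<times>\<^sub>F nhds xbar)"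
      using i by (auto intro!: filterlim_compose[OF _ filterlim_fst] g[rule_format] f[rule_format])
    then show "((\<lambda>z. snd z \<bullet> g i (fst z) - f i (fst z)) \<longlongrightarrow> xbar \<bullet> g i p - f i p) (F \<times>\<^sub>F nhds xbar)"
      by (intro tendsto_intros filterlim_snd)
    show "xbar \<bullet> g i p - f i p \<noteq> 0"
      using i by (auto simp: active_indices_def)
  qed
  then have "\<forall>\<^sub>F z in F \<times>\<^sub>F nhds xbar. \<forall>i\<in>E \<union> I - ?A. snd z \<bullet> g i (fst z) - f i (fst z) \<noteq> 0"
    using assms(1) by (intro eventually_ball_finite) auto
  then show ?thesis
    by (rule eventually_mono) (auto simp: active_indices_def)
qed

section \<open>Error bound and Lipschitz behaviour of the solution sets\<close>

text \<open>Let \<open>z\<close> be the projection of \<open>x\<close> onto the solution set at \<open>q\<close>; it is close to \<open>xbar\<close> because some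
  solution is. The normal vector \<open>x - z\<close> is a combination of an independent family of constraints active
  at \<open>z\<close>. These are active at \<open>(p, xbar)\<close> too, and by \<open>rank\<close> the family is independent already at the
  reference parameter \<open>p\<close>, so its coefficients are bounded by \<open>M * norm (x - z)\<close> with a constant that
  does not depend on \<open>q\<close>. Taking the inner product of \<open>x - z\<close> with itself replaces each vector by the
  residual of its constraint at \<open>x\<close>, whence \<open>(norm (x - z))\<^sup>2 \<le> M * norm (x - z) * r\<close>.

  Without \<open>rank\<close> the families could degenerate as \<open>q\<close> tends to \<open>p\<close>, and a common \<open>M\<close> might not exist.\<close>
lemma error_bound:
  fixes g :: "'i \<Rightarrow> 'p \<Rightarrow> 'h::{real_inner, complete_space}"
  assumes fin: "finite (E \<union> I)" and disj: "E \<inter> I = {}"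
    and g: "\<forall>i\<in>E \<union> I. (g i \<longlongrightarrow> g i p) F"
    and f: "\<forall>i\<in>E \<union> I. (f i \<longlongrightarrow> f i p) F"
    and indep: "independent_family E (\<lambda>i. g i p)"
    and rank: "\<forall>\<^sub>F q in F. \<forall>J. E \<subseteq> J \<and> J \<subseteq> active_indices E I g f p xbar \<longrightarrow>
                 independent_family J (\<lambda>i. g i q) \<longrightarrow> independent_family J (\<lambda>i. g i p)"
    and near: "\<And>e. e > 0 \<Longrightarrow> \<forall>\<^sub>F q in F. \<exists>y\<in>solution_set E I g f q. dist y xbar < e"
  shows "\<exists>a>0. \<forall>\<^sub>F z in F \<times>\<^sub>F nhds xbar. \<forall>r\<ge>0.
      (\<forall>i\<in>E. \<bar>snd z \<bullet> g i (fst z) - f i (fst z)\<bar> \<le> r) \<longrightarrow>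
      (\<forall>i\<in>I. snd z \<bullet> g i (fst z) - f i (fst z) \<le> r) \<longrightarrow>
      (\<exists>y\<in>solution_set E I g f (fst z). norm (snd z - y) \<le> a * r)"
proof -
  let ?A = "active_indices E I g f p xbar" and ?S = "solution_set E I g f"
  obtain M where M: "M > 0"
    "\<forall>\<^sub>F q in F. \<forall>J\<in>{J. J \<subseteq> E \<union> I \<and> independent_family J (\<lambda>i. g i p)}.
       \<forall>c. (\<Sum>i\<in>J. \<bar>c i\<bar>) \<le> M * norm (\<Sum>i\<in>J. c i *\<^sub>R g i q)"
    using uniform_coefficient_bound[of "E \<union> I" g p F] fin g by blast
  obtain P Q where PQ: "eventually P F" "eventually Q (nhds xbar)"
    "\<And>q x. P q \<Longrightarrow> Q x \<Longrightarrow> active_indices E I g f q x \<subseteq> ?A"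
    using active_indices_nearby[OF fin g f, of xbar] unfolding eventually_prod_filter by auto
  obtain \<rho> where \<rho>: "\<rho> > 0" "\<And>x. dist x xbar < \<rho> \<Longrightarrow> Q x"
    using PQ(2) unfolding eventually_nhds_metric by blast
  \<comment> \<open>\<open>dist z xbar \<le> 2 * dist x xbar + dist y xbar\<close> for the projection \<open>z\<close> of \<open>x\<close> and any solution \<open>y\<close>\<close>
  have "\<rho> / 3 > 0" using \<rho>(1) by simp
  let ?good = "\<lambda>q. P q \<and> (\<forall>J. E \<subseteq> J \<and> J \<subseteq> ?A \<longrightarrow>
        independent_family J (\<lambda>i. g i q) \<longrightarrow> independent_family J (\<lambda>i. g i p)) \<and>
      (\<forall>J\<in>{J. J \<subseteq> E \<union> I \<and> independent_family J (\<lambda>i. g i p)}.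
        \<forall>c. (\<Sum>i\<in>J. \<bar>c i\<bar>) \<le> M * norm (\<Sum>i\<in>J. c i *\<^sub>R g i q)) \<and>
      (\<exists>y\<in>?S q. dist y xbar < \<rho> / 3)"
  have good: "eventually ?good F"
    using PQ(1) rank M(2) near[OF \<open>\<rho> / 3 > 0\<close>] by eventually_elim blast
  have close: "\<forall>\<^sub>F x in nhds xbar. dist x xbar < \<rho> / 3"
    using \<open>\<rho> / 3 > 0\<close> unfolding eventually_nhds_metric by blast
  have bound: "\<exists>y\<in>?S q. norm (x - y) \<le> M * r"
    if q: "?good q" and x: "dist x xbar < \<rho> / 3" and "r \<ge> 0"
      and rE: "\<forall>i\<in>E. \<bar>x \<bullet> g i q - f i q\<bar> \<le> r" and rI: "\<forall>i\<in>I. x \<bullet> g i q - f i q \<le> r" for q x r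
  proof -
    obtain y where y: "y \<in> ?S q" "dist y xbar < \<rho> / 3"
      using q by blast
    obtain z where z: "z \<in> ?S q" "x - z \<in> normal_cone z (?S q)" "\<And>y. y \<in> ?S q \<Longrightarrow> norm (x - z) \<le> norm (x - y)"
      using Hilbert_projection[OF closed_solution_set convex_solution_set, of E I g f q x] y(1) by blast
    have "dist z xbar \<le> dist x z + dist x xbar"
      by (metis dist_commute dist_triangle)
    also have "dist x z \<le> dist x y"
      using z(3)[OF y(1)] by (simp add: dist_norm)
    also have "dist x y \<le> dist x xbar + dist y xbar"
      by (rule dist_triangle2)
    finally have "dist z xbar < \<rho>"
      using x y(2) by linarith
    then have act: "active_indices E I g f q z \<subseteq> ?A"
      using PQ(3) \<rho>(2) q by blast
    have "independent_family E (\<lambda>i. g i q)"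
      using q indep fin by (intro independent_family_if_coefficient_bound[of E M]) auto
    then obtain L c where L: "L \<subseteq> active_indices E I g f q z \<inter> I"
      "independent_family (E \<union> L) (\<lambda>i. g i q)" "x - z = (\<Sum>i\<in>E \<union> L. c i *\<^sub>R g i q)" "\<forall>i\<in>L. 0 < c i"
      using normal_cone_multipliers[OF fin disj _ z(1,2)] by blast
    have sub: "E \<union> L \<subseteq> active_indices E I g f q z"
      using L(1) equations_active[OF z(1)] by blast
    then have "independent_family (E \<union> L) (\<lambda>i. g i p)"
      using q L(2) act by blast
    then have cM: "(\<Sum>i\<in>E \<union> L. \<bar>c i\<bar>) \<le> M * norm (x - z)"
      using q L(1) unfolding L(3) by blast
    have summand: "c i * (g i q \<bullet> (x - z)) \<le> \<bar>c i\<bar> * r" if i: "i \<in> E \<union> L" for i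
    proof -
      have eq: "g i q \<bullet> (x - z) = x \<bullet> g i q - f i q"
        using i sub by (auto simp: active_indices_def inner_diff_right inner_commute[of "g _ q"])
      show ?thesis
      proof (cases "i \<in> E")
        case True
        have "c i * (g i q \<bullet> (x - z)) \<le> \<bar>c i\<bar> * \<bar>x \<bullet> g i q - f i q\<bar>"
          unfolding eq by (metis abs_ge_self abs_mult)
        also have "\<dots> \<le> \<bar>c i\<bar> * r"
          using rE True by (intro mult_left_mono) auto
        finally show ?thesis .
      next
        case False
        with i have "i \<in> L" by blast
        then have "0 < c i" "i \<in> I" using L by auto
        then show ?thesis
          unfolding eq using rI by (simp add: mult_left_mono)
      qed
    qed
    have "(norm (x - z))\<^sup>2 = (\<Sum>i\<in>E \<union> L. c i *\<^sub>R g i q) \<bullet> (x - z)"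
      by (simp add: power2_norm_eq_inner flip: L(3))
    also have "\<dots> = (\<Sum>i\<in>E \<union> L. c i * (g i q \<bullet> (x - z)))"
      by (simp add: inner_sum_left)
    also have "\<dots> \<le> (\<Sum>i\<in>E \<union> L. \<bar>c i\<bar> * r)"
      by (intro sum_mono summand)
    also have "\<dots> \<le> M * norm (x - z) * r"
      using mult_right_mono[OF cM \<open>r \<ge> 0\<close>] by (simp add: sum_distrib_right)
    finally have le: "norm (x - z) * norm (x - z) \<le> norm (x - z) * (M * r)"
      by (simp add: power2_eq_square mult_ac)
    have "norm (x - z) \<le> M * r"
    proof (cases "norm (x - z) = 0")
      case True
      then show ?thesis using M(1) \<open>r \<ge> 0\<close> by simp
    next
      case False
      then show ?thesis using le by (simp add: mult_le_cancel_left)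
    qed
    with z(1) show ?thesis by blast
  qed
  have "\<forall>\<^sub>F z in F \<times>\<^sub>F nhds xbar. \<forall>r\<ge>0.
      (\<forall>i\<in>E. \<bar>snd z \<bullet> g i (fst z) - f i (fst z)\<bar> \<le> r) \<longrightarrow>
      (\<forall>i\<in>I. snd z \<bullet> g i (fst z) - f i (fst z) \<le> r) \<longrightarrow>
      (\<exists>y\<in>?S (fst z). norm (snd z - y) \<le> M * r)"
    using eventually_prodI[OF good close]
  proof (rule eventually_mono, intro allI impI)
    fix z r
    assume z: "?good (fst z) \<and> dist (snd z) xbar < \<rho> / 3" and r: "0 \<le> r"
      "\<forall>i\<in>E. \<bar>snd z \<bullet> g i (fst z) - f i (fst z)\<bar> \<le> r"
      "\<forall>i\<in>I. snd z \<bullet> g i (fst z) - f i (fst z) \<le> r"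
    show "\<exists>y\<in>?S (fst z). norm (snd z - y) \<le> M * r"
      by (rule bound[OF conjunct1[OF z] conjunct2[OF z] r])
  qed
  with M(1) show ?thesis by blast
qed

text \<open>A solution at \<open>q1\<close> violates the constraints at \<open>q2\<close> by at most a multiple of \<open>dist q1 q2\<close>, since
  the data are Lipschitz and the solution stays in a bounded region. The error bound at \<open>q2\<close> turns
  this violation into a distance.\<close>
lemma solution_set_Lipschitz_like:
  fixes g :: "'i \<Rightarrow> 'p::metric_space \<Rightarrow> 'h::{real_inner, complete_space}"
  assumes fin: "finite (E \<union> I)" and disj: "E \<inter> I = {}" and p: "p \<in> D"
    and g: "\<forall>i\<in>E \<union> I. locally_lipschitz_on D (g i)"
    and f: "\<forall>i\<in>E \<union> I. locally_lipschitz_on D (f i)"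
    and indep: "independent_family E (\<lambda>i. g i p)"
    and rank: "\<forall>\<^sub>F q in nhds_in D p. \<forall>J. E \<subseteq> J \<and> J \<subseteq> active_indices E I g f p xbar \<longrightarrow>
                 independent_family J (\<lambda>i. g i q) \<longrightarrow> independent_family J (\<lambda>i. g i p)"
    and lim: "xbar \<in> lower_kuratowski_limit D p (solution_set E I g f)"
  shows "\<exists>l. \<forall>\<^sub>F z in (nhds_in D p \<times>\<^sub>F nhds_in D p) \<times>\<^sub>F nhds xbar.
      snd z \<in> solution_set E I g f (fst (fst z)) \<longrightarrow>
      (\<exists>y\<in>solution_set E I g f (snd (fst z)). norm (snd z - y) \<le> l * dist (fst (fst z)) (snd (fst z)))"
proof -
  let ?N = "nhds_in D p"
  have lim_g: "\<forall>i\<in>E \<union> I. (g i \<longlongrightarrow> g i p) ?N" and lim_f: "\<forall>i\<in>E \<union> I. (f i \<longlongrightarrow> f i p) ?N"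
    using g f locally_lipschitz_on_tendsto[OF _ p] by blast+
  have lip: "\<exists>\<Lambda>>0. \<forall>\<^sub>F w in ?N \<times>\<^sub>F ?N. \<forall>i\<in>E \<union> I.
      dist (h i (fst w)) (h i (snd w)) \<le> \<Lambda> * dist (fst w) (snd w)"
    if h: "\<forall>i\<in>E \<union> I. locally_lipschitz_on D (h i)" for h :: "'i \<Rightarrow> 'p \<Rightarrow> 'b::metric_space"
  proof (rule eventually_uniform_constant[OF fin])
    show "\<exists>M. \<forall>\<^sub>F w in ?N \<times>\<^sub>F ?N. dist (h i (fst w)) (h i (snd w)) \<le> M * dist (fst w) (snd w)"
      if "i \<in> E \<union> I" for i
      using h that by (intro locally_lipschitz_on_eventually[OF _ p]) blast
  qed (meson mult_right_mono order_trans zero_le_dist)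
  obtain \<Lambda>g where \<Lambda>g: "\<Lambda>g > 0" "\<forall>\<^sub>F w in ?N \<times>\<^sub>F ?N. \<forall>i\<in>E \<union> I.
      dist (g i (fst w)) (g i (snd w)) \<le> \<Lambda>g * dist (fst w) (snd w)"
    using lip[of g] g by blast
  obtain \<Lambda>f where \<Lambda>f: "\<Lambda>f > 0" "\<forall>\<^sub>F w in ?N \<times>\<^sub>F ?N. \<forall>i\<in>E \<union> I.
      dist (f i (fst w)) (f i (snd w)) \<le> \<Lambda>f * dist (fst w) (snd w)"
    using lip[of f] f by blast
  obtain a where a: "a > 0" "\<forall>\<^sub>F z in ?N \<times>\<^sub>F nhds xbar. \<forall>r\<ge>0.
      (\<forall>i\<in>E. \<bar>snd z \<bullet> g i (fst z) - f i (fst z)\<bar> \<le> r) \<longrightarrow>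
      (\<forall>i\<in>I. snd z \<bullet> g i (fst z) - f i (fst z) \<le> r) \<longrightarrow>
      (\<exists>y\<in>solution_set E I g f (fst z). norm (snd z - y) \<le> a * r)"
    using error_bound[OF fin disj lim_g lim_f indep rank lower_kuratowski_limit_eventually[OF lim]] by blast
  define B where "B = norm xbar + 1"
  have "\<forall>\<^sub>F x in nhds xbar. norm x < B"
    by (rule order_tendstoD[OF tendsto_norm[OF filterlim_ident]]) (simp add: B_def)
  from eventually_compose_filterlim[OF this filterlim_snd]
  have ev1: "\<forall>\<^sub>F z in (?N \<times>\<^sub>F ?N) \<times>\<^sub>F nhds xbar. norm (snd z) < B" .
  have "filterlim (\<lambda>z. (snd (fst z), snd z)) (?N \<times>\<^sub>F nhds xbar) ((?N \<times>\<^sub>F ?N) \<times>\<^sub>F nhds xbar)"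
    by (intro filterlim_Pair filterlim_compose[OF filterlim_snd filterlim_fst] filterlim_snd)
  from eventually_compose_filterlim[OF a(2) this]
  have ev2: "\<forall>\<^sub>F z in (?N \<times>\<^sub>F ?N) \<times>\<^sub>F nhds xbar. \<forall>r\<ge>0.
      (\<forall>i\<in>E. \<bar>snd z \<bullet> g i (snd (fst z)) - f i (snd (fst z))\<bar> \<le> r) \<longrightarrow>
      (\<forall>i\<in>I. snd z \<bullet> g i (snd (fst z)) - f i (snd (fst z)) \<le> r) \<longrightarrow>
      (\<exists>y\<in>solution_set E I g f (snd (fst z)). norm (snd z - y) \<le> a * r)"
    by simp
  note ev3 = eventually_compose_filterlim[OF \<Lambda>g(2) filterlim_fst, of "nhds xbar"]
  note ev4 = eventually_compose_filterlim[OF \<Lambda>f(2) filterlim_fst, of "nhds xbar"]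
  have "\<forall>\<^sub>F z in (?N \<times>\<^sub>F ?N) \<times>\<^sub>F nhds xbar.
      snd z \<in> solution_set E I g f (fst (fst z)) \<longrightarrow>
      (\<exists>y\<in>solution_set E I g f (snd (fst z)).
         norm (snd z - y) \<le> (a * (B * \<Lambda>g + \<Lambda>f)) * dist (fst (fst z)) (snd (fst z)))"
    using ev1 ev2 ev3 ev4
  proof eventually_elim
    case (elim z)
    define q1 q2 x where "q1 = fst (fst z)" and "q2 = snd (fst z)" and "x = snd z"
    note elim = elim[folded q1_def q2_def x_def]
    define r where "r = (B * \<Lambda>g + \<Lambda>f) * dist q1 q2"
    have "r \<ge> 0"
      unfolding r_def B_def using \<Lambda>g(1) \<Lambda>f(1) by (intro mult_nonneg_nonneg add_nonneg_nonneg) auto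
    have drift: "\<bar>(x \<bullet> g i q2 - f i q2) - (x \<bullet> g i q1 - f i q1)\<bar> \<le> r" if i: "i \<in> E \<union> I" for i
    proof -
      have "\<bar>(x \<bullet> g i q2 - f i q2) - (x \<bullet> g i q1 - f i q1)\<bar> \<le> \<bar>x \<bullet> (g i q2 - g i q1)\<bar> + \<bar>f i q1 - f i q2\<bar>"
        by (simp add: inner_diff_right)
      also have "\<bar>x \<bullet> (g i q2 - g i q1)\<bar> \<le> norm x * norm (g i q2 - g i q1)"
        by (rule Cauchy_Schwarz_ineq2)
      also have "\<dots> \<le> B * (\<Lambda>g * dist q1 q2)"
        using elim(1,3) i by (intro mult_mono) (auto simp: dist_norm norm_minus_commute B_def)
      also have "\<bar>f i q1 - f i q2\<bar> \<le> \<Lambda>f * dist q1 q2"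
        using elim(4) i by (simp add: dist_real_def)
      finally show ?thesis
        by (simp add: r_def algebra_simps)
    qed
    show ?case
      unfolding q1_def[symmetric] q2_def[symmetric] x_def[symmetric]
    proof
      assume x: "x \<in> solution_set E I g f q1"
      have "\<forall>i\<in>E. \<bar>x \<bullet> g i q2 - f i q2\<bar> \<le> r"
        using drift x by (fastforce simp: solution_set_def)
      moreover have "\<forall>i\<in>I. x \<bullet> g i q2 - f i q2 \<le> r"
      proof
        fix i assume "i \<in> I"
        then show "x \<bullet> g i q2 - f i q2 \<le> r"
          using drift[of i] x by (auto simp: solution_set_def)
      qed
      ultimately show "\<exists>y\<in>solution_set E I g f q2. norm (x - y) \<le> (a * (B * \<Lambda>g + \<Lambda>f)) * dist q1 q2"
        using elim(2) \<open>r \<ge> 0\<close> by (simp add: r_def mult.assoc)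
    qed
  qed
  then show ?thesis ..
qed

section \<open>Stability of normal vectors and their multipliers\<close>

text \<open>Let \<open>R q\<close> denote the solution set with the inequalities in \<open>K\<close> turned into equations, a subset of
  the full solution set, and \<open>s\<close> the sum of the slacks of \<open>x\<close> over \<open>K\<close>. The error bound gives \<open>y\<close> in
  \<open>R q\<close> with \<open>norm (x - y) \<le> a * s\<close>. The combination \<open>wq\<close> of the vectors at \<open>q\<close> with the reference multipliers
  satisfies \<open>wq \<bullet> (y - x) \<ge> \<kappa> * s\<close>, where \<open>\<kappa>\<close> bounds the multipliers on \<open>K\<close> from below, whereas
  \<open>h \<bullet> (y - x) \<le> 0\<close> for a normal vector \<open>h\<close>. As \<open>h\<close> is close to \<open>wq\<close>, this is
  only possible for \<open>s = 0\<close>: every index in \<open>K\<close> is active at \<open>x\<close>.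

  So \<open>h\<close> is normal to \<open>R q\<close> at \<open>x\<close>, and has multipliers over an independent family that contains
  \<open>E \<union> K\<close>. Applied to \<open>h - wq\<close>, the uniform coefficient bound shows that these are close to the
  reference multipliers, extended by zero.\<close>
lemma normal_cone_stability:
  fixes g :: "'i \<Rightarrow> 'p \<Rightarrow> 'h::{real_inner, complete_space}"
  assumes fin: "finite (E \<union> I)" and disj: "E \<inter> I = {}" and K: "K \<subseteq> active_indices E I g f p xbar \<inter> I"
    and g: "\<forall>i\<in>E \<union> I. (g i \<longlongrightarrow> g i p) F"
    and f: "\<forall>i\<in>E \<union> I. (f i \<longlongrightarrow> f i p) F"
    and indep: "independent_family (E \<union> K) (\<lambda>i. g i p)"
    and rank: "\<forall>\<^sub>F q in F. \<forall>J. E \<union> K \<subseteq> J \<and> J \<subseteq> active_indices E I g f p xbar \<longrightarrow>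
                 independent_family J (\<lambda>i. g i q) \<longrightarrow> independent_family J (\<lambda>i. g i p)"
    and near: "\<And>e. e > 0 \<Longrightarrow> \<forall>\<^sub>F q in F. \<exists>y\<in>solution_set (E \<union> K) (I - K) g f q. dist y xbar < e"
    and w: "w = (\<Sum>i\<in>E \<union> K. lambar i *\<^sub>R g i p)" and pos: "\<forall>i\<in>K. lambar i > 0" and \<epsilon>: "\<epsilon> > 0"
  shows "\<forall>\<^sub>F z in (F \<times>\<^sub>F nhds xbar) \<times>\<^sub>F nhds w.
      snd (fst z) \<in> solution_set E I g f (fst (fst z)) \<longrightarrow>
      snd z \<in> normal_cone (snd (fst z)) (solution_set E I g f (fst (fst z))) \<longrightarrow>
      (\<exists>L c. L \<subseteq> (active_indices E I g f (fst (fst z)) (snd (fst z)) \<inter> I) - K \<and>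
         independent_family (E \<union> K \<union> L) (\<lambda>i. g i p) \<and>
         snd z = (\<Sum>i\<in>E \<union> K \<union> L. c i *\<^sub>R g i (fst (fst z))) \<and>
         (\<forall>i\<in>E \<union> K. \<bar>c i - lambar i\<bar> \<le> \<epsilon>) \<and> (\<forall>i\<in>L. 0 < c i \<and> c i \<le> \<epsilon>))"
proof -
  let ?A = "active_indices E I g f p xbar"
  let ?S = "solution_set E I g f" and ?R = "solution_set (E \<union> K) (I - K) g f"
  have KI: "K \<subseteq> I" using K by blast
  have EKI: "(E \<union> K) \<union> (I - K) = E \<union> I" using KI by blast
  have disj': "(E \<union> K) \<inter> (I - K) = {}" using disj by blast
  have finK: "finite K" "finite (E \<union> K)" using fin KI finite_subset by auto
  obtain a where a: "a > 0" "\<forall>\<^sub>F z in F \<times>\<^sub>F nhds xbar. \<forall>r\<ge>0.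
      (\<forall>i\<in>E \<union> K. \<bar>snd z \<bullet> g i (fst z) - f i (fst z)\<bar> \<le> r) \<longrightarrow>
      (\<forall>i\<in>I - K. snd z \<bullet> g i (fst z) - f i (fst z) \<le> r) \<longrightarrow>
      (\<exists>y\<in>?R (fst z). norm (snd z - y) \<le> a * r)"
    using error_bound[of "E \<union> K" "I - K" g p F f xbar] fin disj' g f indep rank near
    unfolding EKI active_indices_tightened[OF KI] by blast
  obtain M where M: "M > 0"
    "\<forall>\<^sub>F q in F. \<forall>J\<in>{J. J \<subseteq> E \<union> I \<and> independent_family J (\<lambda>i. g i p)}.
       \<forall>c. (\<Sum>i\<in>J. \<bar>c i\<bar>) \<le> M * norm (\<Sum>i\<in>J. c i *\<^sub>R g i q)"
    using uniform_coefficient_bound[of "E \<union> I" g p F] fin g by blast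
  obtain \<kappa> where \<kappa>: "\<kappa> > 0" "\<And>i. i \<in> K \<Longrightarrow> \<kappa> \<le> lambar i"
  proof
    show "Min (insert 1 (lambar ` K)) > 0"
      using finK pos by (subst Min_gr_iff) auto
    show "Min (insert 1 (lambar ` K)) \<le> lambar i" if "i \<in> K" for i
      using finK that by (intro Min_le) auto
  qed
  define wq where "wq q = (\<Sum>i\<in>E \<union> K. lambar i *\<^sub>R g i q)" for q
  let ?N = "(F \<times>\<^sub>F nhds xbar) \<times>\<^sub>F nhds w"
  \<comment> \<open>the first term forces the slacks on \<open>K\<close> to vanish, the second gives the accuracy \<open>\<epsilon>\<close>\<close>
  define \<eta> where "\<eta> = min (\<kappa> / (2 * a)) (\<epsilon> / M)"
  have \<eta>: "\<eta> > 0" "\<eta> * a \<le> \<kappa> / 2" "M * \<eta> \<le> \<epsilon>"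
  proof -
    show "\<eta> > 0" using \<kappa>(1) a(1) M(1) \<epsilon> by (simp add: \<eta>_def)
    have "\<eta> \<le> \<kappa> / (2 * a)" "\<eta> \<le> \<epsilon> / M" by (simp_all add: \<eta>_def)
    then show "\<eta> * a \<le> \<kappa> / 2" "M * \<eta> \<le> \<epsilon>"
      using a(1) M(1) by (simp_all add: field_simps)
  qed
  have limfst: "filterlim (\<lambda>z. fst (fst z)) F ?N"
    by (rule filterlim_compose[OF filterlim_fst filterlim_fst])
  have "((\<lambda>z. g i (fst (fst z))) \<longlongrightarrow> g i p) ?N" if "i \<in> E \<union> K" for i
    using that KI by (intro filterlim_compose[OF g[rule_format] limfst]) blast
  then have "((\<lambda>z. wq (fst (fst z))) \<longlongrightarrow> (\<Sum>i\<in>E \<union> K. lambar i *\<^sub>R g i p)) ?N"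
    unfolding wq_def by (intro tendsto_intros)
  then have "((\<lambda>z. wq (fst (fst z))) \<longlongrightarrow> w) ?N"
    by (simp only: w)
  then have "((\<lambda>z. snd z - wq (fst (fst z))) \<longlongrightarrow> w - w) ?N"
    by (intro tendsto_intros filterlim_snd)
  then have ev1: "\<forall>\<^sub>F z in ?N. norm (snd z - wq (fst (fst z))) < \<eta>"
    using \<eta>(1) by (auto dest: tendstoD)
  note ev2 = eventually_compose_filterlim[OF eventually_conj[OF M(2) rank] limfst]
  note ev3 = eventually_compose_filterlim[OF eventually_conj[OF a(2) active_indices_nearby[OF fin g f, of xbar]] filterlim_fst, of "nhds w"]
  show ?thesis
    using ev1 ev2 ev3
  proof eventually_elim
    case (elim z)
    define q x h where "q = fst (fst z)" and "x = snd (fst z)" and "h = snd z"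
    note elim = elim[folded q_def x_def h_def]
    have bound: "(\<Sum>i\<in>J. \<bar>c i\<bar>) \<le> M * norm (\<Sum>i\<in>J. c i *\<^sub>R g i q)"
      if "J \<subseteq> E \<union> I" "independent_family J (\<lambda>i. g i p)" for J c
      using elim(2) that by blast
    show ?case
      unfolding q_def[symmetric] x_def[symmetric] h_def[symmetric]
    proof (intro impI)
      assume x: "x \<in> ?S q" and h: "h \<in> normal_cone x (?S q)"
      define slack where "slack i = f i q - x \<bullet> g i q" for i
      define s where "s = (\<Sum>i\<in>K. slack i)"
      have slack: "slack i \<ge> 0" if "i \<in> I" for i
        using x that by (simp add: solution_set_def slack_def)
      have slackE: "slack i = 0" if "i \<in> E" for i
        using x that by (simp add: solution_set_def slack_def)
      have slackK: "0 \<le> slack i" "slack i \<le> s" if "i \<in> K" for i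
        using slack that KI finK unfolding s_def by (auto intro!: member_le_sum)
      have "s \<ge> 0" unfolding s_def using slack KI by (intro sum_nonneg) auto
      have "\<forall>i\<in>E \<union> K. \<bar>x \<bullet> g i q - f i q\<bar> \<le> s"
      proof
        fix i assume "i \<in> E \<union> K"
        then show "\<bar>x \<bullet> g i q - f i q\<bar> \<le> s"
          using slackE[of i] slackK[of i] \<open>s \<ge> 0\<close> by (auto simp: slack_def)
      qed
      moreover have "\<forall>i\<in>I - K. x \<bullet> g i q - f i q \<le> s"
      proof
        fix i assume "i \<in> I - K"
        then show "x \<bullet> g i q - f i q \<le> s"
          using slack[of i] \<open>s \<ge> 0\<close> by (simp add: slack_def)
      qed
      ultimately obtain y where y: "y \<in> ?R q" "norm (x - y) \<le> a * s"
        using elim(3) \<open>s \<ge> 0\<close> by blast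
      have "h \<bullet> (y - x) \<le> 0"
        using h y(1) tightened_subset_solution_set[OF KI] by (fastforce simp: normal_cone_def)
      have "g i q \<bullet> (y - x) = slack i" if "i \<in> E \<union> K" for i
        using y(1) that by (simp add: solution_set_def slack_def inner_diff_right inner_commute[of "g i q"])
      then have "wq q \<bullet> (y - x) = (\<Sum>i\<in>E \<union> K. lambar i * slack i)"
        unfolding wq_def inner_sum_left by (intro sum.cong) simp_all
      also have "\<dots> = (\<Sum>i\<in>K. lambar i * slack i)"
        using finK slackE by (intro sum.mono_neutral_right) auto
      finally have wy: "wq q \<bullet> (y - x) = (\<Sum>i\<in>K. lambar i * slack i)" .
      have "\<kappa> * s = (\<Sum>i\<in>K. \<kappa> * slack i)"
        by (simp add: s_def sum_distrib_left)
      also have "\<dots> \<le> wq q \<bullet> (y - x)"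
        unfolding wy using \<kappa>(2) slackK(1) by (intro sum_mono mult_right_mono) auto
      also have "\<dots> \<le> (wq q - h) \<bullet> (y - x)"
        using \<open>h \<bullet> (y - x) \<le> 0\<close> by (simp add: inner_diff_left)
      also have "\<dots> \<le> norm (wq q - h) * norm (y - x)"
        by (rule norm_cauchy_schwarz)
      also have "\<dots> \<le> \<eta> * (a * s)"
        using elim(1) y(2) \<eta>(1) by (intro mult_mono) (auto simp: norm_minus_commute)
      also have "\<dots> \<le> \<kappa> / 2 * s"
        using mult_right_mono[OF \<eta>(2) \<open>s \<ge> 0\<close>] by (simp add: mult.assoc)
      finally have "s \<le> 0"
        using \<kappa>(1) by (simp add: mult_le_0_iff)
      then have slack0: "slack i = 0" if "i \<in> E \<union> K" for i
        using slackE[of i] slackK[of i] that by fastforce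
      then have xR: "x \<in> ?R q"
        using x by (auto simp: solution_set_def slack_def)
      have hR: "h \<in> normal_cone x (?R q)"
        using h tightened_subset_solution_set[OF KI] by (fastforce simp: normal_cone_def)
      have finEKI: "finite ((E \<union> K) \<union> (I - K))"
        using fin EKI by simp
      have indepK: "independent_family (E \<union> K) (\<lambda>i. g i q)"
        using bound[OF _ indep] finK KI by (intro independent_family_if_coefficient_bound[of _ M]) auto
      obtain L c where "L \<subseteq> active_indices (E \<union> K) (I - K) g f q x \<inter> (I - K)"
        and "independent_family (E \<union> K \<union> L) (\<lambda>i. g i q)"
          "h = (\<Sum>i\<in>E \<union> K \<union> L. c i *\<^sub>R g i q)" "\<forall>i\<in>L. 0 < c i"
        by (rule normal_cone_multipliers[OF finEKI disj' indepK xR hR])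
      then have L: "L \<subseteq> active_indices E I g f q x \<inter> (I - K)"
        "independent_family (E \<union> K \<union> L) (\<lambda>i. g i q)" "h = (\<Sum>i\<in>E \<union> K \<union> L. c i *\<^sub>R g i q)" "\<forall>i\<in>L. 0 < c i"
        by (simp_all only: active_indices_tightened[OF KI])
      have "E \<union> K \<union> L \<subseteq> active_indices E I g f q x"
        using equations_active[OF xR] L(1) unfolding active_indices_tightened[OF KI] by blast
      with elim have indepL: "independent_family (E \<union> K \<union> L) (\<lambda>i. g i p)"
        using L(2) by blast
      define b where "b i = (if i \<in> L then 0 else lambar i)" for i
      have finL: "finite (E \<union> K \<union> L)" using L(1) KI by (intro finite_subset[OF _ fin]) blast
      have disjL: "(E \<union> K) \<inter> L = {}" using L(1) disj by blast
      have "wq q = (\<Sum>i\<in>E \<union> K \<union> L. b i *\<^sub>R g i q)"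
        unfolding wq_def b_def using finL disjL by (intro sum.mono_neutral_cong_left) auto
      then have "h - wq q = (\<Sum>i\<in>E \<union> K \<union> L. (c i - b i) *\<^sub>R g i q)"
        by (simp add: L(3) scaleR_left_diff_distrib sum_subtractf)
      then have "(\<Sum>i\<in>E \<union> K \<union> L. \<bar>c i - b i\<bar>) \<le> M * norm (h - wq q)"
        using bound[of "E \<union> K \<union> L" "\<lambda>i. c i - b i"] indepL L(1) KI by auto
      also have "\<dots> \<le> M * \<eta>"
        using elim(1) M(1) by (intro mult_left_mono) auto
      also have "\<dots> \<le> \<epsilon>" by (rule \<eta>(3))
      finally have sum: "(\<Sum>i\<in>E \<union> K \<union> L. \<bar>c i - b i\<bar>) \<le> \<epsilon>" .
      have cb: "\<bar>c i - b i\<bar> \<le> \<epsilon>" if "i \<in> E \<union> K \<union> L" for i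
        using member_le_sum[OF that, of "\<lambda>i. \<bar>c i - b i\<bar>"] finL sum by simp
      have "\<forall>i\<in>E \<union> K. \<bar>c i - lambar i\<bar> \<le> \<epsilon>"
        using cb disjL unfolding b_def by (metis IntI UnI1 empty_iff)
      moreover have "\<forall>i\<in>L. 0 < c i \<and> c i \<le> \<epsilon>"
        using cb L(4) unfolding b_def by fastforce
      ultimately show "\<exists>L c. L \<subseteq> active_indices E I g f q x \<inter> I - K \<and>
         independent_family (E \<union> K \<union> L) (\<lambda>i. g i p) \<and> h = (\<Sum>i\<in>E \<union> K \<union> L. c i *\<^sub>R g i q) \<and>
         (\<forall>i\<in>E \<union> K. \<bar>c i - lambar i\<bar> \<le> \<epsilon>) \<and> (\<forall>i\<in>L. 0 < c i \<and> c i \<le> \<epsilon>)"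
        using L(1,3) indepL by (intro exI[of _ L] exI[of _ c]) blast
    qed
  qed
qed

section \<open>Normal vectors and tightened sets of a stable representation\<close>

text \<open>RCRCQ enters only through \<open>rank\<close>: a family of active constraints that contains \<open>E\<close> and is
  independent at a nearby parameter is independent at \<open>pbar\<close>. Stability supplies the nearby points of
  the tightened sets, with \<open>L = {}\<close> for the multipliers and with every admissible \<open>L\<close> for the Lipschitz
  estimate.\<close>
theorem corollary5p3:
  fixes D :: "'p::real_normed_vector set"
    and q m :: nat
    and I1 I2 :: "nat set"
    and g :: "nat \<Rightarrow> 'p \<Rightarrow> 'h::{real_inner, complete_space}"
    and f :: "nat \<Rightarrow> 'p \<Rightarrow> real"
    and C :: "'p \<Rightarrow> 'h set"
    and pbar :: 'p and xbar vbar :: 'h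
    and E I :: "'i set"
    and gt :: "'i \<Rightarrow> 'p \<Rightarrow> 'h"
    and ft :: "'i \<Rightarrow> 'p \<Rightarrow> real"
    and K :: "'i set"
    and lambar :: "'i \<Rightarrow> real"
  assumes "I1 = {} \<or> I1 = {1..q}"
    and "I2 = {} \<or> I2 = {q+1..m}"
    and "I1 \<union> I2 \<noteq> {}"
    and "\<forall>i\<in>I1 \<union> I2. locally_lipschitz_on D (f i) \<and> locally_lipschitz_on D (g i)"
    and "\<forall>p\<in>D. C p = solution_set I1 I2 g f p"
    and "pbar \<in> D"
    and "xbar \<in> C pbar"
    and "active_indices I1 I2 g f pbar xbar \<noteq> {}"
    and "vbar - xbar \<in> normal_cone xbar (C pbar)"
    and "equivalent_representation D C E I gt ft"
    and "RCRCQ D E I gt ft pbar xbar"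
    and "stable_representation D C E I gt ft pbar vbar xbar K"
    and "vbar - xbar = (\<Sum>i\<in>E \<union> K. lambar i *\<^sub>R gt i pbar)"
  shows "\<exists>ell::real. ell > 0 \<and> (\<forall>\<epsilon>::real. \<epsilon> > 0 \<longrightarrow>
    (\<exists>U V. openin (top_of_set D) U \<and> pbar \<in> U \<and> open V \<and> (0::'h) \<in> V \<and>
      (\<forall>p\<in>U. \<forall>x \<in> C p \<inter> (+) xbar ` V. \<forall>x' \<in> normal_cone x (C p) \<inter> (+) (vbar - xbar) ` V.
        (active_indices E I gt ft p x \<inter> I) - K \<subseteq> (active_indices E I gt ft pbar xbar \<inter> I) - K \<and>
        (\<exists>L. L \<subseteq> (active_indices E I gt ft p x \<inter> I) - K \<and>
           independent_family (E \<union> K \<union> L) (\<lambda>i. gt i pbar) \<and>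
           (\<exists>lam. x' = (\<Sum>i\<in>E \<union> K \<union> L. lam i *\<^sub>R gt i p) \<and>
              (\<forall>i\<in>E \<union> K. lambar i - \<epsilon> \<le> lam i \<and> lam i \<le> lambar i + \<epsilon>) \<and>
              (\<forall>i\<in>L. 0 < lam i \<and> lam i \<le> \<epsilon>)))) \<and>
      (\<forall>L. L \<subseteq> (active_indices E I gt ft pbar xbar \<inter> I) - K \<and>
           independent_family (E \<union> K \<union> L) (\<lambda>i. gt i pbar) \<longrightarrow>
        (\<forall>p1\<in>U. \<forall>p2\<in>U. \<forall>x1 \<in> (+) xbar ` V \<inter> tightened_set E I gt ft K L p1.
           \<exists>x2 \<in> tightened_set E I gt ft K L p2. norm (x1 - x2) \<le> ell * norm (p1 - p2)))))"
proof -
  let ?N = "nhds_in D pbar" and ?A = "active_indices E I gt ft pbar xbar"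
  let ?w = "vbar - xbar"
  let ?\<L> = "{L. L \<subseteq> (?A \<inter> I) - K \<and> independent_family (E \<union> K \<union> L) (\<lambda>i. gt i pbar)}"
  note pD = assms(6)
  have rep: "E \<inter> I = {}" "finite (E \<union> I)" "\<And>p. p \<in> D \<Longrightarrow> C p = solution_set E I gt ft p"
    and lip: "\<forall>i\<in>E \<union> I. locally_lipschitz_on D (gt i)" "\<forall>i\<in>E \<union> I. locally_lipschitz_on D (ft i)"
    using assms(10) by (auto simp: equivalent_representation_def)
  have lim: "\<forall>i\<in>E \<union> I. (gt i \<longlongrightarrow> gt i pbar) ?N" "\<forall>i\<in>E \<union> I. (ft i \<longlongrightarrow> ft i pbar) ?N"
    using lip locally_lipschitz_on_tendsto[OF _ pD] by blast+
  have K: "K \<subseteq> ?A \<inter> I" and indep: "independent_family (E \<union> K) (\<lambda>i. gt i pbar)"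
    and liminf: "\<And>L. L \<in> ?\<L> \<Longrightarrow> xbar \<in> lower_kuratowski_limit D pbar (tightened_set E I gt ft K L)"
    using assms(12) by (auto simp: stable_representation_def)
  have finA: "finite ?A"
    using rep(2) by (simp add: active_indices_def)

  \<comment> \<open>independence makes the multipliers unique, so \<open>lambar\<close> inherits the signs that stability provides\<close>
  have pos: "\<forall>i\<in>K. lambar i > 0"
  proof -
    obtain lam where lam: "?w = (\<Sum>i\<in>E \<union> K. lam i *\<^sub>R gt i pbar)" "\<forall>i\<in>K. lam i > 0"
      using assms(12) by (auto simp: stable_representation_def)
    have "(\<Sum>i\<in>E \<union> K. (lambar i - lam i) *\<^sub>R gt i pbar) = 0"
      using lam(1) assms(13) by (simp add: scaleR_left_diff_distrib sum_subtractf)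
    moreover have "finite (E \<union> K)"
      using rep(2) K finite_subset by auto
    ultimately have "\<forall>i\<in>E \<union> K. lambar i - lam i = 0"
      using indep unfolding independent_family_iff[OF \<open>finite (E \<union> K)\<close>]
      by (elim allE[of _ "\<lambda>i. lambar i - lam i"]) simp
    with lam(2) show ?thesis by force
  qed

  have rank: "\<forall>\<^sub>F q in ?N. \<forall>J. E \<subseteq> J \<and> J \<subseteq> ?A \<longrightarrow>
      independent_family J (\<lambda>i. gt i q) \<longrightarrow> independent_family J (\<lambda>i. gt i pbar)"
  proof -
    obtain U where U: "openin (top_of_set D) U" "pbar \<in> U"
      and dim: "\<forall>J. E \<subseteq> J \<and> J \<subseteq> ?A \<longrightarrow>
        (\<forall>p\<in>U. dim ((\<lambda>i. gt i p) ` J) = dim ((\<lambda>i. gt i pbar) ` J))"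
      using assms(11) unfolding RCRCQ_def by (elim exE conjE)
    have "\<forall>\<^sub>F q in ?N. \<forall>J. E \<subseteq> J \<and> J \<subseteq> ?A \<longrightarrow>
        dim ((\<lambda>i. gt i q) ` J) = dim ((\<lambda>i. gt i pbar) ` J)"
      unfolding eventually_nhds_in_openin[OF pD]
    proof (intro exI[of _ U] conjI ballI allI impI U)
      fix q J assume q: "q \<in> U" and J: "E \<subseteq> J \<and> J \<subseteq> ?A"
      show "dim ((\<lambda>i. gt i q) ` J) = dim ((\<lambda>i. gt i pbar) ` J)"
        by (rule bspec[OF dim[THEN spec, THEN mp, OF J] q])
    qed
    then show ?thesis
    proof (rule eventually_mono, intro allI impI)
      fix q J
      assume "\<forall>J. E \<subseteq> J \<and> J \<subseteq> ?A \<longrightarrow> dim ((\<lambda>i. gt i q) ` J) = dim ((\<lambda>i. gt i pbar) ` J)"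
        and J: "E \<subseteq> J \<and> J \<subseteq> ?A" and "independent_family J (\<lambda>i. gt i q)"
      moreover from J finA have "finite J"
        using finite_subset by blast
      ultimately show "independent_family J (\<lambda>i. gt i pbar)"
        by (simp add: independent_family_dim)
    qed
  qed

  have "\<exists>l>0. \<forall>\<^sub>F z in (?N \<times>\<^sub>F ?N) \<times>\<^sub>F nhds xbar. \<forall>L\<in>?\<L>.
      snd z \<in> tightened_set E I gt ft K L (fst (fst z)) \<longrightarrow>
      (\<exists>y\<in>tightened_set E I gt ft K L (snd (fst z)).
         norm (snd z - y) \<le> l * dist (fst (fst z)) (snd (fst z)))"
  proof (rule eventually_uniform_constant)
    show "finite ?\<L>" using finA by simp
    show "\<exists>l. \<forall>\<^sub>F z in (?N \<times>\<^sub>F ?N) \<times>\<^sub>F nhds xbar.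
        snd z \<in> tightened_set E I gt ft K L (fst (fst z)) \<longrightarrow>
        (\<exists>y\<in>tightened_set E I gt ft K L (snd (fst z)).
           norm (snd z - y) \<le> l * dist (fst (fst z)) (snd (fst z)))" if L: "L \<in> ?\<L>" for L
    proof -
      \<comment> \<open>the error bound is applied with \<open>E \<union> K \<union> L\<close> as the set of equations\<close>
      let ?K = "K \<union> L"
      have KI: "?K \<subseteq> I" and union: "(E \<union> ?K) \<union> (I - ?K) = E \<union> I"
        and disj: "(E \<union> ?K) \<inter> (I - ?K) = {}"
        using K L rep(1) by blast+
      have set: "tightened_set E I gt ft K L = solution_set (E \<union> ?K) (I - ?K) gt ft"
        by (rule ext) (simp add: tightened_set_def Un_assoc)
      have indepL: "independent_family (E \<union> ?K) (\<lambda>i. gt i pbar)"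
        using L by (simp add: Un_assoc)
      have rankL: "\<forall>\<^sub>F q in ?N. \<forall>J. E \<union> ?K \<subseteq> J \<and> J \<subseteq> ?A \<longrightarrow>
          independent_family J (\<lambda>i. gt i q) \<longrightarrow> independent_family J (\<lambda>i. gt i pbar)"
        using rank by (rule eventually_mono) blast
      show ?thesis
        unfolding set
        using solution_set_Lipschitz_like[of "E \<union> ?K" "I - ?K" pbar D gt ft xbar,
            unfolded union active_indices_tightened[OF KI], OF rep(2) disj pD lip indepL rankL]
          liminf[OF L] unfolding set by blast
    qed
  qed (meson mult_right_mono order_trans zero_le_dist)
  then obtain l where l: "l > 0" "\<forall>\<^sub>F z in (?N \<times>\<^sub>F ?N) \<times>\<^sub>F nhds xbar. \<forall>L\<in>?\<L>.
      snd z \<in> tightened_set E I gt ft K L (fst (fst z)) \<longrightarrow>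
      (\<exists>y\<in>tightened_set E I gt ft K L (snd (fst z)).
         norm (snd z - y) \<le> l * dist (fst (fst z)) (snd (fst z)))"
    by blast
  obtain U1 U2 V1 where UV1: "eventually U1 ?N" "eventually U2 ?N" "eventually V1 (nhds xbar)"
    "\<And>p1 p2 x L. U1 p1 \<Longrightarrow> U2 p2 \<Longrightarrow> V1 x \<Longrightarrow> L \<in> ?\<L> \<Longrightarrow> x \<in> tightened_set E I gt ft K L p1 \<Longrightarrow>
       \<exists>y\<in>tightened_set E I gt ft K L p2. norm (x - y) \<le> l * dist p1 p2"
    using l(2) unfolding eventually_prod_filter by force

  obtain U3 V3 where UV3: "eventually U3 ?N" "eventually V3 (nhds xbar)"
    "\<And>p x. U3 p \<Longrightarrow> V3 x \<Longrightarrow> active_indices E I gt ft p x \<subseteq> ?A"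
    using active_indices_nearby[OF rep(2) lim, of xbar] unfolding eventually_prod_filter by auto

  have rankK: "\<forall>\<^sub>F q in ?N. \<forall>J. E \<union> K \<subseteq> J \<and> J \<subseteq> ?A \<longrightarrow>
      independent_family J (\<lambda>i. gt i q) \<longrightarrow> independent_family J (\<lambda>i. gt i pbar)"
    using rank by (rule eventually_mono) blast
  have near: "\<forall>\<^sub>F q in ?N. \<exists>y\<in>solution_set (E \<union> K) (I - K) gt ft q. dist y xbar < e" if "e > 0" for e
    using lower_kuratowski_limit_eventually[OF liminf[of "{}"] that] indep
    by (simp add: tightened_set_def)
  note cone = normal_cone_stability[OF rep(2,1) K lim indep rankK near assms(13) pos]

  show ?thesis
  proof (intro exI[of _ l] conjI allI impI l(1))
    fix \<epsilon> :: real assume "\<epsilon> > 0"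
    from cone[OF _ this]
    obtain U4 V4 W where UV4: "eventually U4 ?N" "eventually V4 (nhds xbar)" "eventually W (nhds ?w)"
      "\<And>p x h. U4 p \<Longrightarrow> V4 x \<Longrightarrow> W h \<Longrightarrow> x \<in> solution_set E I gt ft p \<Longrightarrow>
         h \<in> normal_cone x (solution_set E I gt ft p) \<Longrightarrow>
         \<exists>L c. L \<subseteq> (active_indices E I gt ft p x \<inter> I) - K \<and>
           independent_family (E \<union> K \<union> L) (\<lambda>i. gt i pbar) \<and>
           h = (\<Sum>i\<in>E \<union> K \<union> L. c i *\<^sub>R gt i p) \<and>
           (\<forall>i\<in>E \<union> K. \<bar>c i - lambar i\<bar> \<le> \<epsilon>) \<and> (\<forall>i\<in>L. 0 < c i \<and> c i \<le> \<epsilon>)"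
      unfolding eventually_prod_filter by force
    have "\<forall>\<^sub>F q in ?N. U1 q \<and> U2 q \<and> U3 q \<and> U4 q"
      using UV1(1,2) UV3(1) UV4(1) by eventually_elim blast
    then obtain U where U: "openin (top_of_set D) U" "pbar \<in> U"
      "\<And>q. q \<in> U \<Longrightarrow> U1 q \<and> U2 q \<and> U3 q \<and> U4 q"
      unfolding eventually_nhds_in_openin[OF pD] by blast
    have UD: "U \<subseteq> D" using U(1) by (rule openin_imp_subset)
    have "\<forall>\<^sub>F x in nhds xbar. V1 x \<and> V3 x \<and> V4 x"
      using UV1(3) UV3(2) UV4(2) by eventually_elim blast
    then obtain d1 where d1: "d1 > 0" "\<And>x. dist x xbar < d1 \<Longrightarrow> V1 x \<and> V3 x \<and> V4 x"
      unfolding eventually_nhds_metric by blast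
    obtain d2 where d2: "d2 > 0" "\<And>h. dist h ?w < d2 \<Longrightarrow> W h"
      using UV4(3) unfolding eventually_nhds_metric by blast
    define V where "V = ball (0::'h) (min d1 d2)"
    have V: "dist x z < d1" "dist x z < d2" if "x \<in> (+) z ` V" for x z :: 'h
      using that by (auto simp: V_def dist_norm norm_minus_commute)
    show "\<exists>U V. openin (top_of_set D) U \<and> pbar \<in> U \<and> open V \<and> (0::'h) \<in> V \<and>
      (\<forall>p\<in>U. \<forall>x \<in> C p \<inter> (+) xbar ` V. \<forall>x' \<in> normal_cone x (C p) \<inter> (+) (vbar - xbar) ` V.
        (active_indices E I gt ft p x \<inter> I) - K \<subseteq> (active_indices E I gt ft pbar xbar \<inter> I) - K \<and>
        (\<exists>L. L \<subseteq> (active_indices E I gt ft p x \<inter> I) - K \<and>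
           independent_family (E \<union> K \<union> L) (\<lambda>i. gt i pbar) \<and>
           (\<exists>lam. x' = (\<Sum>i\<in>E \<union> K \<union> L. lam i *\<^sub>R gt i p) \<and>
              (\<forall>i\<in>E \<union> K. lambar i - \<epsilon> \<le> lam i \<and> lam i \<le> lambar i + \<epsilon>) \<and>
              (\<forall>i\<in>L. 0 < lam i \<and> lam i \<le> \<epsilon>)))) \<and>
      (\<forall>L. L \<subseteq> (active_indices E I gt ft pbar xbar \<inter> I) - K \<and>
           independent_family (E \<union> K \<union> L) (\<lambda>i. gt i pbar) \<longrightarrow>
        (\<forall>p1\<in>U. \<forall>p2\<in>U. \<forall>x1 \<in> (+) xbar ` V \<inter> tightened_set E I gt ft K L p1.
           \<exists>x2 \<in> tightened_set E I gt ft K L p2. norm (x1 - x2) \<le> l * norm (p1 - p2)))"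
    proof (rule exI[of _ U], rule exI[of _ V], intro conjI ballI allI impI)
      show "openin (top_of_set D) U" "pbar \<in> U" by (fact U)+
      show "open V" "0 \<in> V" using d1 d2 by (simp_all add: V_def)
    next
      fix p x x'
      assume p: "p \<in> U" and x: "x \<in> C p \<inter> (+) xbar ` V"
      have "active_indices E I gt ft p x \<subseteq> ?A"
        using U(3)[OF p] d1(2)[OF V(1)] x by (intro UV3(3)) auto
      then show "(active_indices E I gt ft p x \<inter> I) - K \<subseteq> (?A \<inter> I) - K"
        by blast
      assume x': "x' \<in> normal_cone x (C p) \<inter> (+) ?w ` V"
      have "\<exists>L c. L \<subseteq> (active_indices E I gt ft p x \<inter> I) - K \<and>
           independent_family (E \<union> K \<union> L) (\<lambda>i. gt i pbar) \<and>
           x' = (\<Sum>i\<in>E \<union> K \<union> L. c i *\<^sub>R gt i p) \<and>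
           (\<forall>i\<in>E \<union> K. \<bar>c i - lambar i\<bar> \<le> \<epsilon>) \<and> (\<forall>i\<in>L. 0 < c i \<and> c i \<le> \<epsilon>)"
      proof (rule UV4(4))
        show "U4 p" using U(3)[OF p] by blast
        show "V4 x" using d1(2)[OF V(1)] x by blast
        show "W x'" using d2(2)[OF V(2)] x' by blast
        have "C p = solution_set E I gt ft p" using rep(3) p UD by blast
        then show "x \<in> solution_set E I gt ft p" "x' \<in> normal_cone x (solution_set E I gt ft p)"
          using x x' by auto
      qed
      then obtain L c where L: "L \<subseteq> (active_indices E I gt ft p x \<inter> I) - K"
        "independent_family (E \<union> K \<union> L) (\<lambda>i. gt i pbar)"
        "x' = (\<Sum>i\<in>E \<union> K \<union> L. c i *\<^sub>R gt i p)"
        "\<And>i. i \<in> E \<union> K \<Longrightarrow> \<bar>c i - lambar i\<bar> \<le> \<epsilon>" "\<forall>i\<in>L. 0 < c i \<and> c i \<le> \<epsilon>"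
        by blast
      have "\<forall>i\<in>E \<union> K. lambar i - \<epsilon> \<le> c i \<and> c i \<le> lambar i + \<epsilon>"
      proof
        fix i assume "i \<in> E \<union> K"
        from L(4)[OF this] show "lambar i - \<epsilon> \<le> c i \<and> c i \<le> lambar i + \<epsilon>"
          by linarith
      qed
      with L show "\<exists>L. L \<subseteq> (active_indices E I gt ft p x \<inter> I) - K \<and>
           independent_family (E \<union> K \<union> L) (\<lambda>i. gt i pbar) \<and>
           (\<exists>lam. x' = (\<Sum>i\<in>E \<union> K \<union> L. lam i *\<^sub>R gt i p) \<and>
              (\<forall>i\<in>E \<union> K. lambar i - \<epsilon> \<le> lam i \<and> lam i \<le> lambar i + \<epsilon>) \<and>
              (\<forall>i\<in>L. 0 < lam i \<and> lam i \<le> \<epsilon>))"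
        by blast
    next
      fix L p1 p2 x1
      assume L: "L \<subseteq> (?A \<inter> I) - K \<and> independent_family (E \<union> K \<union> L) (\<lambda>i. gt i pbar)"
        and p12: "p1 \<in> U" "p2 \<in> U" and x1: "x1 \<in> (+) xbar ` V \<inter> tightened_set E I gt ft K L p1"
      have "\<exists>y\<in>tightened_set E I gt ft K L p2. norm (x1 - y) \<le> l * dist p1 p2"
        using U(3)[OF p12(1)] U(3)[OF p12(2)] d1(2)[OF V(1)] x1 L by (intro UV1(4)) blast+
      then show "\<exists>x2\<in>tightened_set E I gt ft K L p2. norm (x1 - x2) \<le> l * norm (p1 - p2)"
        by (simp add: dist_norm)
    qed
  qed
qed

end
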